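(* Let $p\ge 1$, $\theta\in\mathbb{R}^p$, $\sigma>0$, and consider the linear model $Y=\mathbb{X}\theta+\sigma W$ with $n$ observations and deterministic feature matrix $\mathbb{X}\in\mathbb{R}^{n\times p}$ with rows $X_1^\top,\dots,X_n^\top$. Suppose that (A) $C_n:=\frac1n\sum_{i=1}^nX_iX_i^\top\to C$ as $n\to\infty$, where $C$ is a positive definite matrix with smallest eigenvalue $c_{\min}>0$; (B) there is a constant $C_X<\infty$ independent of $n$ such that $\|X_i\|_2\le C_X$ for all $i$; (C) there is $C_\theta<\infty$ such that $\|\theta\|_1\le C_\theta$; (D) the noise variables $W_i\sim P_i$ are independent and there is $\tau<\infty$ independent of $i$ such that $E_{P_i}[e^{tW_i}]\le e^{\tau^2t^2/2}$ for all $t\in\mathbb{R}$. Let $\widehat\lambda_n$ be the leave-one-out cross-validated tuning parameter and $\lambda_n$ the oracle tuning parameter of the lasso. Then $$R_n(\widehat\lambda_n)-R_n(\lambda_n)\to 0\quad\text{as } n\to\infty,$$ where $R_n$ is the predictive risk and $R_n(\widehat\lambda_n)$ is understood as $\frac1n\mathbb{E}\|\mathbb{X}(\widehat\theta(\widehat\lambda_n)-\theta)\|_2^2+\sigma^2$.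
   Context: The dimension $p$ is fixed and $n\to\infty$. $Y=(Y_1,\dots,Y_n)^\top$ and $W=(W_1,\dots,W_n)^\top$, so $Y_i=X_i^\top\theta+\sigma W_i$. $\mathbb{P}=\prod_iP_i$ is the joint (product) law of the noise and $\mathbb{E}$ is expectation under $\mathbb{P}$. The matrix $\mathbb{X}$ is assumed to have full column rank. For $\lambda\ge0$ the lasso estimator is the unique minimizer $$\widehat\theta(\lambda):=\operatorname{argmin}_{\vartheta\in\mathbb{R}^p}\frac1{2n}\|Y-\mathbb{X}\vartheta\|_2^2+\lambda\|\vartheta\|_1 .$$ $\widehat\theta^{(i)}(\lambda)$ denotes the lasso estimator computed from all observations except the $i$-th, i.e. the minimizer of $\frac1{2(n-1)}\sum_{j\ne i}(Y_j-X_j^\top\vartheta)^2+\lambda\|\vartheta\|_1$ (for $n$ large the reduced design also has full column rank, so this is unique). Predictive risk: $R_n(\lambda):=\frac1n\mathbb{E}\|\mathbb{X}(\widehat\theta(\lambda)-\theta)\|_2^2+\sigma^2$. Leave-one-out cross-validation estimator of risk: $\widehat R_n(\lambda):=\frac1n\sum_{i=1}^n(Y_i-X_i^\top\widehat\theta^{(i)}(\lambda))^2$. $\Lambda\subset[0,\infty)$ is a (large) compact set. $\widehat\lambda_n:=\operatorname{argmin}_{\lambda\in\Lambda}\widehat R_n(\lambda)$ and $\lambda_n:=\operatorname{argmin}_{\lambda\in\mathbb{R}^+}R_n(\lambda)$. It is a standing assumption that $\lambda_n\in\Lambda$ for all $n$. The expectation defining $R_n(\widehat\lambda_n)$ is over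 all the data, including the data used to select $\widehat\lambda_n$, so $R_n(\widehat\lambda_n)-R_n(\lambda_n)$ is a deterministic sequence. *)

theory Defs
  imports "HOL-Probability.Probability"
begin

(* The rows of the design form one sequence X 0, X 1, ...; the problem with n observations
   uses the rows with index i < n.  The dimension p is CARD('p). *)

definition l1_norm :: "real^'p \<Rightarrow> real" where
  "l1_norm v = (\<Sum>j\<in>UNIV. \<bar>v $ j\<bar>)"

definition outer :: "real^'p \<Rightarrow> real^'p^'p" where
  "outer x = (\<chi> a b. x $ a * x $ b)"

definition sample_gram :: "(nat \<Rightarrow> real^'p) \<Rightarrow> nat \<Rightarrow> real^'p^'p" where
  "sample_gram X n = (1 / real n) *\<^sub>R (\<Sum>i<n. outer (X i))"

(* Linear independence of the p columns of the n x p matrix with rows X 0, ..., X (n - 1):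
   X i \<bullet> v is entry i of the combination of the columns with coefficients v. *)
definition full_column_rank :: "(nat \<Rightarrow> real^'p) \<Rightarrow> nat \<Rightarrow> bool" where
  "full_column_rank X n \<longleftrightarrow> (\<forall>v. (\<forall>i<n. X i \<bullet> v = 0) \<longrightarrow> v = 0)"

definition pos_def_matrix :: "real^'p^'p \<Rightarrow> bool" where
  "pos_def_matrix A \<longleftrightarrow> transpose A = A \<and> (\<forall>v. v \<noteq> 0 \<longrightarrow> 0 < v \<bullet> (A *v v))"

definition matrix_eigenvalue :: "real^'p^'p \<Rightarrow> real \<Rightarrow> bool" where
  "matrix_eigenvalue A \<mu> \<longleftrightarrow> (\<exists>v. v \<noteq> 0 \<and> A *v v = \<mu> *\<^sub>R v)"

definition smallest_eigenvalue :: "real^'p^'p \<Rightarrow> real \<Rightarrow> bool" where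
  "smallest_eigenvalue A c \<longleftrightarrow>
     matrix_eigenvalue A c \<and> (\<forall>\<mu>. matrix_eigenvalue A \<mu> \<longrightarrow> c \<le> \<mu>)"

(* Integrability is explicit because the Bochner integral of a non-integrable function is 0. *)
definition subgaussian_mgf :: "real \<Rightarrow> real measure \<Rightarrow> bool" where
  "subgaussian_mgf \<tau> P \<longleftrightarrow>
     (\<forall>t. integrable P (\<lambda>w. exp (t * w)) \<and> (\<integral>w. exp (t * w) \<partial>P) \<le> exp (\<tau>\<^sup>2 * t\<^sup>2 / 2))"

definition response :: "(nat \<Rightarrow> real^'p) \<Rightarrow> real^'p \<Rightarrow> real \<Rightarrow> (nat \<Rightarrow> real) \<Rightarrow> nat \<Rightarrow> real" where
  "response X \<theta> \<sigma> w i = X i \<bullet> \<theta> + \<sigma> * w i"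

definition lasso_objective ::
    "nat set \<Rightarrow> (nat \<Rightarrow> real^'p) \<Rightarrow> (nat \<Rightarrow> real) \<Rightarrow> real \<Rightarrow> real^'p \<Rightarrow> real" where
  "lasso_objective I X y l \<theta> =
     1 / (2 * real (card I)) * (\<Sum>i\<in>I. (y i - X i \<bullet> \<theta>)\<^sup>2) + l * l1_norm \<theta>"

(* The lasso estimator from the observations with index in I.  It is the unique minimizer when
   the rows indexed by I have full column rank; otherwise the choice is unspecified. *)
definition lasso ::
    "nat set \<Rightarrow> (nat \<Rightarrow> real^'p) \<Rightarrow> (nat \<Rightarrow> real) \<Rightarrow> real \<Rightarrow> real^'p" where
  "lasso I X y l = arg_min (lasso_objective I X y l) (\<lambda>_. True)"

definition loocv_risk :: "(nat \<Rightarrow> real^'p) \<Rightarrow> (nat \<Rightarrow> real) \<Rightarrow> nat \<Rightarrow> real \<Rightarrow> real" where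
  "loocv_risk X y n l = 1 / real n * (\<Sum>i<n. (y i - X i \<bullet> lasso ({..<n} - {i}) X y l)\<^sup>2)"

(* Predictive risk with a tuning parameter L that may depend on the data; the expectation is
   over everything, including L. *)
definition pred_risk_random ::
    "'a measure \<Rightarrow> (nat \<Rightarrow> 'a \<Rightarrow> real) \<Rightarrow> (nat \<Rightarrow> real^'p) \<Rightarrow> real^'p \<Rightarrow> real \<Rightarrow>
     nat \<Rightarrow> ('a \<Rightarrow> real) \<Rightarrow> real" where
  "pred_risk_random M W X \<theta> \<sigma> n L =
     1 / real n *
       (\<integral>\<omega>. (\<Sum>i<n. (X i \<bullet> (lasso {..<n} X (response X \<theta> \<sigma> (\<lambda>j. W j \<omega>)) (L \<omega>) - \<theta>))\<^sup>2) \<partial>M)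
     + \<sigma>\<^sup>2"

definition pred_risk ::
    "'a measure \<Rightarrow> (nat \<Rightarrow> 'a \<Rightarrow> real) \<Rightarrow> (nat \<Rightarrow> real^'p) \<Rightarrow> real^'p \<Rightarrow> real \<Rightarrow>
     nat \<Rightarrow> real \<Rightarrow> real" where
  "pred_risk M W X \<theta> \<sigma> n l = pred_risk_random M W X \<theta> \<sigma> n (\<lambda>_. l)"

(* The minimizer need not be unique, so this holds of every random variable selecting one.
   Measurability is what makes the expectation of the loss at L meaningful. *)
definition cv_parameter ::
    "'a measure \<Rightarrow> (nat \<Rightarrow> 'a \<Rightarrow> real) \<Rightarrow> (nat \<Rightarrow> real^'p) \<Rightarrow> real^'p \<Rightarrow> real \<Rightarrow> real set \<Rightarrow>
     nat \<Rightarrow> ('a \<Rightarrow> real) \<Rightarrow> bool" where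
  "cv_parameter M W X \<theta> \<sigma> \<Lambda> n L \<longleftrightarrow>
     L \<in> borel_measurable M \<and>
     (\<forall>\<omega>\<in>space M.
        is_arg_min (loocv_risk X (response X \<theta> \<sigma> (\<lambda>j. W j \<omega>)) n) (\<lambda>l. l \<in> \<Lambda>) (L \<omega>))"

definition risk_minimizer ::
    "'a measure \<Rightarrow> (nat \<Rightarrow> 'a \<Rightarrow> real) \<Rightarrow> (nat \<Rightarrow> real^'p) \<Rightarrow> real^'p \<Rightarrow> real \<Rightarrow>
     nat \<Rightarrow> real \<Rightarrow> bool" where
  "risk_minimizer M W X \<theta> \<sigma> n l \<longleftrightarrow> is_arg_min (pred_risk M W X \<theta> \<sigma> n) (\<lambda>u. 0 \<le> u) l"

end

theory Submission
  imports Defs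
begin

text \<open>
  Cross-validation works here because every estimator involved stays close, uniformly over the
  bounded set of tuning parameters, to one deterministic curve: the lasso
  \<open>u(l)\<close> computed from the noiseless responses \<open>X i \<bullet> \<theta>\<close>.  In a fixed dimension the design is
  eventually uniformly well conditioned, and a strongly convex problem is stable: its minimizer
  moves by at most a constant times the change of the gradient of its smooth part and of the
  penalty level (\<open>minimizer_stability\<close>).  This single estimate is used four times.

  \<^item> Adding the noise \<open>e\<close> changes the gradient by \<open>g = (1/n) (\<Sum>i<n. e i *\<^sub>R X i)\<close>, so the
    lasso moves by \<open>O(\<parallel>g\<parallel>)\<close>, with a constant free of the tuning parameter.
  \<^item> Deleting observation \<open>i\<close> as well changes it by a further \<open>O((1 + \<bar>e i\<bar>) / n)\<close>.
  \<^item> Lowering the penalty to \<open>0\<close>, where the noiseless minimizer is \<open>\<theta>\<close> itself, bounds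
    \<open>u(l) - \<theta>\<close> on bounded sets of tuning parameters.
  \<^item> The lasso is a continuous function of the responses and the tuning parameter together,
    so its loss at a data-dependent tuning parameter is a random variable.

  Write \<open>ideal l\<close> for the prediction loss of \<open>u(l)\<close>.  Expanding squares, the
  loss of the lasso equals \<open>ideal l\<close>, and the cross-validation criterion equals
  \<open>ideal l\<close> plus the mean squared noise, up to multiples of one random variable, the
  \<open>noise_envelope\<close>, which does not depend on \<open>l\<close>.  The mean squared noise does not depend on
  \<open>l\<close> either, so it does not influence the minimization: a minimizer of the criterion nearly
  minimizes \<open>ideal\<close>, and so does the oracle.  Hence their risks differ by at most a constant times
  the expected envelope (\<open>selection_risk_gap\<close>).  As the noise is centred and independent with
  bounded variances, \<open>\<parallel>g\<parallel>\<^sup>2\<close> has expectation \<open>O(1/n)\<close> and the envelope has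
  expectation \<open>O(1/sqrt n)\<close>.
\<close>

section \<open>Stability of the lasso\<close>

text \<open>
  The quadratic form of the Gram matrix of the rows in \<open>I\<close>.  At \<open>u - \<theta>\<close> it is the prediction
  loss of \<open>u\<close>, and a lower bound \<open>c * (norm v)\<^sup>2\<close> on it expresses that the design is well
  conditioned.
\<close>
definition gram_form :: "nat set \<Rightarrow> (nat \<Rightarrow> real^'p) \<Rightarrow> real^'p \<Rightarrow> real" where
  "gram_form I X v = (\<Sum>i\<in>I. (X i \<bullet> v)\<^sup>2) / real (card I)"

text \<open>
  The negative gradient at \<open>u\<close> of the squared-error part of the lasso objective.
\<close>
definition score :: "nat set \<Rightarrow> (nat \<Rightarrow> real^'p) \<Rightarrow> (nat \<Rightarrow> real) \<Rightarrow> real^'p \<Rightarrow> real^'p" where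
  "score I X y u = (1 / real (card I)) *\<^sub>R (\<Sum>i\<in>I. (y i - X i \<bullet> u) *\<^sub>R X i)"

lemma l1_norm_nonneg: "0 \<le> l1_norm v"
  by (simp add: l1_norm_def sum_nonneg)

lemma l1_norm_convex:
  assumes "0 \<le> t" "t \<le> 1"
  shows "l1_norm (u + t *\<^sub>R (v - u)) \<le> l1_norm u + t * (l1_norm v - l1_norm u)"
proof -
  have "\<bar>(u + t *\<^sub>R (v - u)) $ j\<bar> \<le> (1 - t) * \<bar>u $ j\<bar> + t * \<bar>v $ j\<bar>" for j
  proof -
    have "(u + t *\<^sub>R (v - u)) $ j = (1 - t) * u $ j + t * v $ j"
      by (simp add: algebra_simps)
    then show ?thesis
      using abs_triangle_ineq[of "(1 - t) * u $ j" "t * v $ j"] assms by (simp add: abs_mult)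
  qed
  then have "l1_norm (u + t *\<^sub>R (v - u)) \<le> (\<Sum>j\<in>UNIV. (1 - t) * \<bar>u $ j\<bar> + t * \<bar>v $ j\<bar>)"
    unfolding l1_norm_def by (intro sum_mono) auto
  also have "\<dots> = (1 - t) * l1_norm u + t * l1_norm v"
    by (simp add: l1_norm_def sum.distrib sum_distrib_left)
  finally show ?thesis by (simp add: algebra_simps)
qed

lemma l1_norm_diff_le:
  fixes u v :: "real^'p"
  shows "\<bar>l1_norm u - l1_norm v\<bar> \<le> real CARD('p) * norm (u - v)"
proof -
  have "\<bar>l1_norm u - l1_norm v\<bar> \<le> (\<Sum>j\<in>UNIV. \<bar>\<bar>u $ j\<bar> - \<bar>v $ j\<bar>\<bar>)"
    unfolding l1_norm_def sum_subtractf[symmetric] by (rule sum_abs)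
  also have "\<dots> \<le> (\<Sum>j\<in>(UNIV::'p set). norm (u - v))"
  proof (rule sum_mono)
    fix j
    have "\<bar>\<bar>u $ j\<bar> - \<bar>v $ j\<bar>\<bar> \<le> \<bar>(u - v) $ j\<bar>" by simp
    also have "\<dots> \<le> norm (u - v)" by (rule component_le_norm_cart)
    finally show "\<bar>\<bar>u $ j\<bar> - \<bar>v $ j\<bar>\<bar> \<le> norm (u - v)" .
  qed
  finally show ?thesis by simp
qed

lemma gram_form_le:
  assumes B: "\<And>i. norm (X i) \<le> b"
  shows "gram_form I X v \<le> b\<^sup>2 * (norm v)\<^sup>2"
proof -
  have "(X i \<bullet> v)\<^sup>2 \<le> b\<^sup>2 * (norm v)\<^sup>2" for i
  proof -
    have "\<bar>X i \<bullet> v\<bar> \<le> b * norm v"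
      by (rule order_trans[OF Cauchy_Schwarz_ineq2 mult_right_mono[OF B]]) simp
    then have "\<bar>X i \<bullet> v\<bar>\<^sup>2 \<le> (b * norm v)\<^sup>2" by (rule power_mono) simp
    then show ?thesis by (simp add: power_mult_distrib)
  qed
  then have "(\<Sum>i\<in>I. (X i \<bullet> v)\<^sup>2) \<le> real (card I) * (b\<^sup>2 * (norm v)\<^sup>2)"
    by (rule sum_bounded_above)
  then show ?thesis
    by (cases "card I = 0") (auto simp: gram_form_def field_simps)
qed

text \<open>
  A lower bound on the quadratic form of the design makes the objective grow quadratically, so a
  minimum over a large ball is a global one.  It exists, hence the choice operator in the
  definition of the lasso picks a minimizer.
\<close>
lemma lasso_minimizes:
  fixes X :: "nat \<Rightarrow> real^'p"
  assumes c: "c > 0" and co: "\<And>v. c * (norm v)\<^sup>2 \<le> gram_form I X v" and l: "l \<ge> 0"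
  shows "lasso_objective I X y l (lasso I X y l) \<le> lasso_objective I X y l \<theta>"
proof -
  let ?F = "lasso_objective I X y l"
  define m where "m = 1 / (2 * real (card I)) * (\<Sum>i\<in>I. (y i)\<^sup>2)"
  have m: "m \<ge> 0" by (simp add: m_def sum_nonneg)
  define R where "R = sqrt (8 * m / c)"
  have R: "R \<ge> 0" using m c by (simp add: R_def)
  have F0: "?F 0 = m" by (simp add: lasso_objective_def m_def l1_norm_def)
  have low: "c / 4 * (norm v)\<^sup>2 - m \<le> ?F v" for v
  proof -
    have pt: "(X i \<bullet> v)\<^sup>2 / 2 - (y i)\<^sup>2 \<le> (y i - X i \<bullet> v)\<^sup>2" for i
    proof -
      have "0 \<le> (2 * y i - X i \<bullet> v)\<^sup>2" by simp
      then show ?thesis by (simp add: power2_eq_square algebra_simps)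
    qed
    have "(\<Sum>i\<in>I. (X i \<bullet> v)\<^sup>2) / 2 - (\<Sum>i\<in>I. (y i)\<^sup>2) \<le> (\<Sum>i\<in>I. (y i - X i \<bullet> v)\<^sup>2)"
      unfolding sum_divide_distrib sum_subtractf[symmetric] by (rule sum_mono) (rule pt)
    then have "1 / (2 * real (card I)) * ((\<Sum>i\<in>I. (X i \<bullet> v)\<^sup>2) / 2 - (\<Sum>i\<in>I. (y i)\<^sup>2))
        \<le> 1 / (2 * real (card I)) * (\<Sum>i\<in>I. (y i - X i \<bullet> v)\<^sup>2)"
      by (rule mult_left_mono) simp
    moreover have "1 / (2 * real (card I)) * ((\<Sum>i\<in>I. (X i \<bullet> v)\<^sup>2) / 2 - (\<Sum>i\<in>I. (y i)\<^sup>2))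
        = gram_form I X v / 4 - m"
      unfolding gram_form_def m_def by (simp add: algebra_simps)
    moreover have "0 \<le> l * l1_norm v" using l by (intro mult_nonneg_nonneg l1_norm_nonneg)
    ultimately show ?thesis using co[of v] unfolding lasso_objective_def by linarith
  qed
  have "continuous_on (cball 0 R) ?F"
    unfolding lasso_objective_def l1_norm_def by (intro continuous_intros)
  then obtain x where x: "x \<in> cball 0 R" "\<And>v. v \<in> cball 0 R \<Longrightarrow> ?F x \<le> ?F v"
    using continuous_attains_inf[of "cball 0 R" ?F] R by auto
  have "?F x \<le> ?F v" for v
  proof (cases "v \<in> cball 0 R")
    case False
    then have "R\<^sup>2 < (norm v)\<^sup>2" using R by (intro power_strict_mono) auto
    then have "8 * m < c * (norm v)\<^sup>2" using m c by (simp add: R_def field_simps)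
    then have "?F 0 < ?F v" using low[of v] F0 by linarith
    moreover have "?F x \<le> ?F 0" using x(2)[of 0] R by simp
    ultimately show ?thesis by simp
  qed (rule x)
  then have "is_arg_min ?F (\<lambda>_. True) x" by (auto simp: is_arg_min_def not_less)
  then have "is_arg_min ?F (\<lambda>_. True) (lasso I X y l)"
    unfolding lasso_def arg_min_def by (rule someI)
  then show ?thesis by (auto simp: is_arg_min_def not_less)
qed

lemma inner_score:
  "score I X y u \<bullet> v = (\<Sum>i\<in>I. (y i - X i \<bullet> u) * (X i \<bullet> v)) / real (card I)"
  unfolding score_def by (simp add: inner_sum_left)

text \<open>
  First-order optimality.  Moving from \<open>u\<close> a fraction \<open>t\<close> of the way to \<open>v\<close> cannot lower the
  objective; the smooth part changes by a linear term in \<open>t\<close> plus \<open>t\<^sup>2 * b\<close>, and by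
  convexity the penalty increases by at most \<open>t\<close> times its total change.  Divide by \<open>t\<close> and let
  \<open>t\<close> tend to \<open>0\<close>.
\<close>
lemma minimizer_variational:
  assumes opt: "\<And>w. lasso_objective I X y l u \<le> lasso_objective I X y l w" and l: "l \<ge> 0"
  shows "score I X y u \<bullet> (v - u) \<le> l * (l1_norm v - l1_norm u)"
proof -
  define a where "a = score I X y u \<bullet> (v - u)"
  define b where "b = gram_form I X (v - u) / 2"
  have b: "b \<ge> 0" by (simp add: b_def gram_form_def sum_nonneg)
  have exp: "a \<le> l * (l1_norm v - l1_norm u) + t * b" if t: "0 < t" "t \<le> 1" for t
  proof -
    have pt: "(y i - X i \<bullet> (u + t *\<^sub>R (v - u)))\<^sup>2
        = (y i - X i \<bullet> u)\<^sup>2 - 2 * t * ((y i - X i \<bullet> u) * (X i \<bullet> (v - u))) + t\<^sup>2 * (X i \<bullet> (v - u))\<^sup>2" for i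
      by (simp add: inner_add_right power2_eq_square algebra_simps)
    have S: "(\<Sum>i\<in>I. (y i - X i \<bullet> (u + t *\<^sub>R (v - u)))\<^sup>2) = (\<Sum>i\<in>I. (y i - X i \<bullet> u)\<^sup>2)
        - 2 * t * (\<Sum>i\<in>I. (y i - X i \<bullet> u) * (X i \<bullet> (v - u))) + t\<^sup>2 * (\<Sum>i\<in>I. (X i \<bullet> (v - u))\<^sup>2)"
      unfolding pt by (simp only: sum.distrib sum_subtractf sum_distrib_left)
    have a': "a = (\<Sum>i\<in>I. (y i - X i \<bullet> u) * (X i \<bullet> (v - u))) / real (card I)"
      unfolding a_def by (rule inner_score)
    have "lasso_objective I X y l (u + t *\<^sub>R (v - u)) =
        1 / (2 * real (card I)) * (\<Sum>i\<in>I. (y i - X i \<bullet> u)\<^sup>2) - t * a + t\<^sup>2 * b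
         + l * l1_norm (u + t *\<^sub>R (v - u))"
      unfolding lasso_objective_def S a' b_def gram_form_def
      by (cases "card I = 0") (auto simp: field_simps)
    moreover have "l * l1_norm (u + t *\<^sub>R (v - u)) \<le> l * (l1_norm u + t * (l1_norm v - l1_norm u))"
      using t l by (intro mult_left_mono l1_norm_convex) auto
    ultimately have "t * a \<le> t\<^sup>2 * b + l * (t * (l1_norm v - l1_norm u))"
      using opt[of "u + t *\<^sub>R (v - u)"] unfolding lasso_objective_def[of I X y l u]
      by (simp add: algebra_simps)
    then have "t * a \<le> t * (l * (l1_norm v - l1_norm u) + t * b)"
      by (simp add: power2_eq_square algebra_simps)
    then show ?thesis using t by simp
  qed
  have "a \<le> l * (l1_norm v - l1_norm u) + e" if e: "e > 0" for e
  proof -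
    define t where "t = min 1 (e / (b + 1))"
    have "0 < t" "t \<le> 1" using e b by (auto simp: t_def)
    moreover have "t * b \<le> e"
    proof -
      have "t * b \<le> e / (b + 1) * (b + 1)" using e b by (intro mult_mono) (auto simp: t_def)
      then show ?thesis using b by simp
    qed
    ultimately show ?thesis using exp[of t] by linarith
  qed
  then show ?thesis unfolding a_def by (rule field_le_epsilon)
qed

text \<open>
  Adding the optimality conditions of the two minimizers, each tested against the other, cancels
  the penalties up to the difference of the levels and leaves the quadratic form of the second
  design at \<open>v - u\<close>.  Both gradients are taken at the first minimizer, which in the approximation
  results is the noiseless one and hence bounded.
\<close>
lemma minimizer_stability:
  fixes X :: "nat \<Rightarrow> real^'p"
  assumes u: "\<And>w. lasso_objective I X y l u \<le> lasso_objective I X y l w" "l \<ge> 0"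
    and v: "\<And>w. lasso_objective J X z m v \<le> lasso_objective J X z m w" "m \<ge> 0"
    and co: "\<And>w. c * (norm w)\<^sup>2 \<le> gram_form J X w"
  shows "c * norm (v - u) \<le> norm (score I X y u - score J X z u) + real CARD('p) * \<bar>l - m\<bar>"
proof (cases "v = u")
  case False
  \<comment> \<open>Move the second gradient from \<open>v\<close> to \<open>u\<close>; the difference is the quadratic form.\<close>
  have "(\<Sum>i\<in>J. (z i - X i \<bullet> v) * (X i \<bullet> (u - v)))
      = (\<Sum>i\<in>J. (z i - X i \<bullet> u) * (X i \<bullet> (u - v)) + (X i \<bullet> (v - u))\<^sup>2)"
    by (rule sum.cong) (simp_all add: inner_diff_right power2_eq_square algebra_simps)
  then have sv: "score J X z v \<bullet> (u - v) = score J X z u \<bullet> (u - v) + gram_form J X (v - u)"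
    unfolding inner_score gram_form_def by (simp add: sum.distrib add_divide_distrib)
  have "gram_form J X (v - u) \<le> (score I X y u - score J X z u) \<bullet> (u - v)
        + (l - m) * (l1_norm v - l1_norm u)"
    using minimizer_variational[OF u, of v] minimizer_variational[OF v, of u] sv
    by (simp add: inner_diff_left inner_diff_right algebra_simps)
  also have "\<dots> \<le> norm (score I X y u - score J X z u) * norm (v - u)
        + \<bar>l - m\<bar> * (real CARD('p) * norm (v - u))"
  proof (rule add_mono)
    show "(score I X y u - score J X z u) \<bullet> (u - v) \<le> norm (score I X y u - score J X z u) * norm (v - u)"
      using norm_cauchy_schwarz[of "score I X y u - score J X z u" "u - v"]
      by (simp add: norm_minus_commute)
    show "(l - m) * (l1_norm v - l1_norm u) \<le> \<bar>l - m\<bar> * (real CARD('p) * norm (v - u))"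
      using mult_left_mono[OF l1_norm_diff_le[of v u], of "\<bar>l - m\<bar>"]
        abs_ge_self[of "(l - m) * (l1_norm v - l1_norm u)"] by (simp add: abs_mult)
  qed
  finally have "c * norm (v - u) * norm (v - u)
      \<le> (norm (score I X y u - score J X z u) + real CARD('p) * \<bar>l - m\<bar>) * norm (v - u)"
    using co[of "v - u"] by (simp add: power2_eq_square algebra_simps)
  then show ?thesis using False by simp
qed simp

section \<open>Measurability of the lasso\<close>

text \<open>
  By stability the lasso is continuous in responses and penalty level jointly, where the sequence
  of responses carries the product topology; a continuous function of measurable data is
  measurable.
\<close>
lemma borel_measurable_lasso:
  fixes X :: "nat \<Rightarrow> real^'p"
  assumes c: "c > 0" and co: "\<And>v. c * (norm v)\<^sup>2 \<le> gram_form I X v"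
    and y: "\<And>i. (\<lambda>\<omega>. y \<omega> i) \<in> borel_measurable M"
    and L: "L \<in> borel_measurable M" and L0: "\<And>\<omega>. \<omega> \<in> space M \<Longrightarrow> 0 \<le> L \<omega>"
  shows "(\<lambda>\<omega>. lasso I X (y \<omega>) (L \<omega>)) \<in> borel_measurable M"
proof -
  let ?S = "UNIV \<times> {0..} :: ((nat \<Rightarrow> real) \<times> real) set"
  let ?\<Phi> = "\<lambda>s. lasso I X (fst s) (snd s)"
  have cont: "continuous_on ?S ?\<Phi>"
    unfolding continuous_on_def
  proof
    fix s assume s: "s \<in> ?S"
    let ?h = "\<lambda>r. (norm (score I X (fst s) (?\<Phi> s) - score I X (fst r) (?\<Phi> s))
                    + real CARD('p) * \<bar>snd s - snd r\<bar>) / c"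
    have "continuous_on UNIV (\<lambda>r :: (nat \<Rightarrow> real) \<times> real. fst r i)" for i
      by (rule continuous_on_product_then_coordinatewise) (intro continuous_intros)
    then have "continuous_on UNIV ?h"
      unfolding score_def by (intro continuous_intros) (use c in auto)
    then have "(?h \<longlongrightarrow> ?h s) (at s within ?S)"
      by (meson UNIV_I continuous_on_def subset_UNIV tendsto_within_subset)
    then have h: "(?h \<longlongrightarrow> 0) (at s within ?S)" by simp
    have "dist (?\<Phi> r) (?\<Phi> s) \<le> ?h r" if r: "r \<in> ?S" for r
    proof -
      have "c * norm (?\<Phi> r - ?\<Phi> s) \<le> norm (score I X (fst s) (?\<Phi> s) - score I X (fst r) (?\<Phi> s))
                    + real CARD('p) * \<bar>snd s - snd r\<bar>"
        using r s by (intro minimizer_stability lasso_minimizes[OF c co] co) auto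
      then show ?thesis using c by (simp add: dist_norm field_simps)
    qed
    then have "\<forall>\<^sub>F r in at s within ?S. dist (?\<Phi> r) (?\<Phi> s) \<le> ?h r"
      by (auto simp: eventually_at_filter)
    then have "((\<lambda>r. dist (?\<Phi> r) (?\<Phi> s)) \<longlongrightarrow> 0) (at s within ?S)"
      by (intro tendsto_sandwich[OF _ _ tendsto_const h]) auto
    then show "(?\<Phi> \<longlongrightarrow> ?\<Phi> s) (at s within ?S)" by (rule iffD2[OF tendsto_dist_iff])
  qed
  have "y \<in> borel_measurable M" using y by (rule measurable_coordinatewise_then_product)
  then have "(\<lambda>\<omega>. (y \<omega>, L \<omega>)) \<in> borel_measurable M" using L by (rule borel_measurable_Pair)
  then have "(\<lambda>\<omega>. (y \<omega>, L \<omega>)) \<in> measurable M (restrict_space borel ?S)"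
    using L0 by (intro measurable_restrict_space2) auto
  from measurable_compose[OF this borel_measurable_continuous_on_restrict[OF cont]]
  show ?thesis by simp
qed

section \<open>Moments of the noise\<close>

text \<open>
  The square of \<open>w\<close> is at most twice \<open>exp w + exp (- w)\<close>.  For the mean \<open>m\<close>, the inequality
  \<open>1 + t * W \<le> exp (t * W)\<close> gives \<open>t * m \<le> \<tau>\<^sup>2 * t\<^sup>2\<close> for all small \<open>t\<close> of either sign,
  which forces \<open>m = 0\<close>.
\<close>
lemma (in prob_space) subgaussian_moments:
  assumes meas[measurable]: "W \<in> borel_measurable M"
    and sg: "subgaussian_mgf \<tau> (distr M borel W)"
  shows "integrable M (\<lambda>\<omega>. (W \<omega>)\<^sup>2)" and "integrable M W" and "(\<integral>\<omega>. W \<omega> \<partial>M) = 0"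
    and "(\<integral>\<omega>. (W \<omega>)\<^sup>2 \<partial>M) \<le> 4 * exp (\<tau>\<^sup>2 / 2)"
proof -
  have ie: "integrable M (\<lambda>\<omega>. exp (t * W \<omega>))"
    and le: "(\<integral>\<omega>. exp (t * W \<omega>) \<partial>M) \<le> exp (\<tau>\<^sup>2 * t\<^sup>2 / 2)" for t
  proof -
    have "integrable (distr M borel W) (\<lambda>w. exp (t * w))"
      using sg by (auto simp: subgaussian_mgf_def)
    then show "integrable M (\<lambda>\<omega>. exp (t * W \<omega>))"
      by (subst (asm) integrable_distr_eq) auto
    have "(\<integral>w. exp (t * w) \<partial>distr M borel W) = (\<integral>\<omega>. exp (t * W \<omega>) \<partial>M)"
      by (rule integral_distr) auto
    then show "(\<integral>\<omega>. exp (t * W \<omega>) \<partial>M) \<le> exp (\<tau>\<^sup>2 * t\<^sup>2 / 2)"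
      using sg unfolding subgaussian_mgf_def by metis
  qed
  have cosh: "w\<^sup>2 \<le> 2 * (exp (1 * w) + exp ((- 1) * w))" for w :: real
  proof -
    have "w\<^sup>2 / 2 \<le> exp w + exp (- w)" if "w \<ge> 0" for w :: real
      using exp_lower_Taylor_quadratic[OF that] exp_ge_add_one_self[of "- w"] by simp
    from this[of w] this[of "- w"] show ?thesis by (cases "w \<ge> 0") auto
  qed
  have ic: "integrable M (\<lambda>\<omega>. 2 * (exp (1 * W \<omega>) + exp ((- 1) * W \<omega>)))"
    by (intro integrable_mult_right Bochner_Integration.integrable_add ie)
  show i2: "integrable M (\<lambda>\<omega>. (W \<omega>)\<^sup>2)"
    by (rule Bochner_Integration.integrable_bound[OF ic])
      (use cosh in \<open>auto intro!: AE_I2 simp: abs_of_nonneg add_nonneg_nonneg\<close>)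
  show i1: "integrable M W"
    by (rule square_integrable_imp_integrable[OF meas i2])
  have "(\<integral>\<omega>. (W \<omega>)\<^sup>2 \<partial>M) \<le> (\<integral>\<omega>. 2 * (exp (1 * W \<omega>) + exp ((- 1) * W \<omega>)) \<partial>M)"
    by (rule integral_mono[OF i2 ic cosh])
  also have "\<dots> = 2 * ((\<integral>\<omega>. exp (1 * W \<omega>) \<partial>M) + (\<integral>\<omega>. exp ((- 1) * W \<omega>) \<partial>M))"
    by (subst integral_mult_right_zero, subst Bochner_Integration.integral_add[OF ie ie]) simp
  also have "\<dots> \<le> 4 * exp (\<tau>\<^sup>2 / 2)" using le[of 1] le[of "- 1"] by simp
  finally show "(\<integral>\<omega>. (W \<omega>)\<^sup>2 \<partial>M) \<le> 4 * exp (\<tau>\<^sup>2 / 2)" .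
  define m where "m = (\<integral>\<omega>. W \<omega> \<partial>M)"
  have lin: "t * m \<le> \<tau>\<^sup>2 * t\<^sup>2" if t: "\<tau>\<^sup>2 * t\<^sup>2 \<le> 1" for t
  proof -
    have "1 + t * m = (\<integral>\<omega>. 1 + t * W \<omega> \<partial>M)"
      unfolding m_def using i1 by (simp add: prob_space)
    also have "\<dots> \<le> (\<integral>\<omega>. exp (t * W \<omega>) \<partial>M)"
      using i1 ie by (intro integral_mono) (auto simp: exp_ge_add_one_self)
    also have "\<dots> \<le> exp (\<tau>\<^sup>2 * t\<^sup>2 / 2)" by (rule le)
    also have "\<dots> \<le> 1 + 2 * (\<tau>\<^sup>2 * t\<^sup>2 / 2)"
      using t by (intro real_exp_bound_lemma) auto
    finally show ?thesis by simp
  qed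
  \<comment> \<open>The sign \<open>s\<close> treats positive and negative \<open>t\<close> at once.\<close>
  have "s * m \<le> 0" if s: "\<bar>s\<bar> = 1" for s
  proof (rule field_le_epsilon)
    fix e :: real assume e: "e > 0"
    define t where "t = min 1 e / (1 + \<tau>\<^sup>2)"
    have d: "1 + \<tau>\<^sup>2 \<ge> 1" "1 + \<tau>\<^sup>2 > 0" by (auto intro: add_pos_nonneg)
    then have "t * (1 + \<tau>\<^sup>2) = min 1 e" by (simp add: t_def)
    then have t: "t > 0" "t * (1 + \<tau>\<^sup>2) \<le> 1" "t * (1 + \<tau>\<^sup>2) \<le> e"
      using e d by (auto simp: t_def)
    have t2: "\<tau>\<^sup>2 * t \<le> t * (1 + \<tau>\<^sup>2)" "t \<le> t * (1 + \<tau>\<^sup>2)" using t(1) by (auto simp: algebra_simps)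
    have "\<tau>\<^sup>2 * t\<^sup>2 = (\<tau>\<^sup>2 * t) * t" by (simp add: power2_eq_square)
    also have "\<dots> \<le> 1 * 1" using t t2 by (intro mult_mono) linarith+
    finally have small: "\<tau>\<^sup>2 * t\<^sup>2 \<le> 1" by simp
    have "s\<^sup>2 = 1" using s by (metis power2_abs one_power2)
    then have st: "(s * t)\<^sup>2 = t\<^sup>2" by (simp add: power_mult_distrib)
    have "(s * t) * m \<le> \<tau>\<^sup>2 * t\<^sup>2" using lin[of "s * t"] small unfolding st .
    then have "t * (s * m) \<le> t * (\<tau>\<^sup>2 * t)" by (simp add: power2_eq_square mult_ac)
    then have "s * m \<le> \<tau>\<^sup>2 * t" using t(1) by simp
    then show "s * m \<le> 0 + e" using t t2 by linarith
  qed
  from this[of 1] this[of "- 1"] show "(\<integral>\<omega>. W \<omega> \<partial>M) = 0" by (simp add: m_def)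
qed

text \<open>
  Expand the square: the cross terms vanish by independence and centring.
\<close>
lemma (in prob_space) expectation_norm_sum_le:
  fixes X :: "nat \<Rightarrow> 'b::euclidean_space"
  assumes ind: "indep_vars (\<lambda>_. borel) W UNIV"
    and i1: "\<And>i. integrable M (W i)" and i2: "\<And>i. integrable M (\<lambda>\<omega>. (W i \<omega>)\<^sup>2)"
    and z: "\<And>i. (\<integral>\<omega>. W i \<omega> \<partial>M) = 0" and v: "\<And>i. (\<integral>\<omega>. (W i \<omega>)\<^sup>2 \<partial>M) \<le> K"
    and B: "\<And>i. norm (X i) \<le> b"
  shows "integrable M (\<lambda>\<omega>. (norm (\<Sum>i<n. W i \<omega> *\<^sub>R X i))\<^sup>2)"
    and "(\<integral>\<omega>. (norm (\<Sum>i<n. W i \<omega> *\<^sub>R X i))\<^sup>2 \<partial>M) \<le> real n * (K * b\<^sup>2)"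
proof -
  have expand: "(norm (\<Sum>i<n. W i \<omega> *\<^sub>R X i))\<^sup>2
      = (\<Sum>i<n. \<Sum>j<n. (X i \<bullet> X j) * (W i \<omega> * W j \<omega>))" for \<omega>
    unfolding power2_norm_eq_inner
    by (simp add: inner_sum_left inner_sum_right sum_distrib_left mult_ac inner_commute)
  have cross: "integrable M (\<lambda>\<omega>. W i \<omega> * W j \<omega>) \<and> (\<integral>\<omega>. W i \<omega> * W j \<omega> \<partial>M) = 0" if "i \<noteq> j" for i j
  proof -
    have "indep_vars (\<lambda>_. borel) W {i, j}" by (rule indep_vars_subset[OF ind]) auto
    from indep_vars_integrable[OF _ this] indep_vars_lebesgue_integral[OF _ this] i1 that z
    show ?thesis by simp
  qed
  have int: "integrable M (\<lambda>\<omega>. W i \<omega> * W j \<omega>)" for i j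
    using cross[of i j] i2[of i] by (cases "i = j") (auto simp: power2_eq_square)
  show "integrable M (\<lambda>\<omega>. (norm (\<Sum>i<n. W i \<omega> *\<^sub>R X i))\<^sup>2)"
    unfolding expand by (intro Bochner_Integration.integrable_sum integrable_mult_right int)
  have "(\<integral>\<omega>. (norm (\<Sum>i<n. W i \<omega> *\<^sub>R X i))\<^sup>2 \<partial>M)
      = (\<Sum>i<n. \<Sum>j<n. (X i \<bullet> X j) * (\<integral>\<omega>. W i \<omega> * W j \<omega> \<partial>M))"
    unfolding expand by (simp add: Bochner_Integration.integral_sum int Bochner_Integration.integrable_sum)
  also have "\<dots> = (\<Sum>i<n. (X i \<bullet> X i) * (\<integral>\<omega>. W i \<omega> * W i \<omega> \<partial>M))"
  proof (rule sum.cong[OF refl])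
    fix i assume i: "i \<in> {..<n}"
    have "(\<Sum>j<n. (X i \<bullet> X j) * (\<integral>\<omega>. W i \<omega> * W j \<omega> \<partial>M))
        = (\<Sum>j<n. if j = i then (X i \<bullet> X i) * (\<integral>\<omega>. W i \<omega> * W i \<omega> \<partial>M) else 0)"
      using cross by (intro sum.cong) auto
    then show "(\<Sum>j<n. (X i \<bullet> X j) * (\<integral>\<omega>. W i \<omega> * W j \<omega> \<partial>M)) = (X i \<bullet> X i) * (\<integral>\<omega>. W i \<omega> * W i \<omega> \<partial>M)"
      using i by simp
  qed
  also have "\<dots> \<le> (\<Sum>i<n. K * b\<^sup>2)"
  proof (rule sum_mono)
    fix i
    have "0 \<le> (\<integral>\<omega>. (W i \<omega>)\<^sup>2 \<partial>M)" by simp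
    then have "(norm (X i))\<^sup>2 * (\<integral>\<omega>. (W i \<omega>)\<^sup>2 \<partial>M) \<le> b\<^sup>2 * K"
      using v[of i] B[of i] by (intro mult_mono power_mono) auto
    then show "(X i \<bullet> X i) * (\<integral>\<omega>. W i \<omega> * W i \<omega> \<partial>M) \<le> K * b\<^sup>2"
      by (simp only: power2_norm_eq_inner power2_eq_square[of "W i \<omega>" for \<omega>] mult.commute[of K])
  qed
  finally show "(\<integral>\<omega>. (norm (\<Sum>i<n. W i \<omega> *\<^sub>R X i))\<^sup>2 \<partial>M) \<le> real n * (K * b\<^sup>2)" by simp
qed

section \<open>Approximation by the noiseless lasso\<close>

definition noise_score :: "(nat \<Rightarrow> real^'p) \<Rightarrow> (nat \<Rightarrow> real) \<Rightarrow> nat \<Rightarrow> real^'p" where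
  "noise_score X e n = (1 / real n) *\<^sub>R (\<Sum>i<n. e i *\<^sub>R X i)"

text \<open>
  Up to constant factors, one bound, free of the tuning parameter, for all errors made by
  replacing the lasso with the noiseless one.  The weights \<open>sqrt n\<close> and \<open>1 / sqrt n\<close> turn first-order terms
  \<open>G * x\<close>, with \<open>G\<^sup>2\<close> of expected order \<open>1/n\<close> and \<open>x\<close> bounded in mean square, into squares of equal
  order: \<open>2 * G * x \<le> x\<^sup>2 / sqrt n + sqrt n * G\<^sup>2\<close>.  So second moments control the envelope.
\<close>
definition noise_envelope :: "(nat \<Rightarrow> real^'p) \<Rightarrow> (nat \<Rightarrow> real) \<Rightarrow> nat \<Rightarrow> real" where
  "noise_envelope X e n = 1 / sqrt n + sqrt n * (norm (noise_score X e n))\<^sup>2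
     + (\<Sum>i<n. (e i)\<^sup>2) / real n / sqrt n"

lemma le_weighted_square:
  fixes r G :: real
  assumes "r > 0"
  shows "2 * G * x \<le> x\<^sup>2 / r + r * G\<^sup>2"
proof -
  have "0 \<le> (x - r * G)\<^sup>2 / r" using assms by simp
  also have "(x - r * G)\<^sup>2 / r = x\<^sup>2 / r + r * G\<^sup>2 - 2 * G * x"
    using assms by (simp add: power2_eq_square field_simps)
  finally show ?thesis by simp
qed

lemma noise_score_le_envelope:
  assumes "n \<ge> 1"
  shows "norm (noise_score X e n) \<le> noise_envelope X e n"
    and "(norm (noise_score X e n))\<^sup>2 \<le> noise_envelope X e n"
proof -
  let ?G = "norm (noise_score X e n)" and ?r = "sqrt (real n)"
  have r: "?r \<ge> 1" using assms by simp
  have rest: "0 \<le> (\<Sum>i<n. (e i)\<^sup>2) / real n / ?r" "0 \<le> 1 / ?r" by (auto intro!: divide_nonneg_nonneg sum_nonneg)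
  have "2 * ?G * 1 \<le> 1\<^sup>2 / ?r + ?r * ?G\<^sup>2" using r by (intro le_weighted_square) auto
  then have "?G \<le> 1 / ?r + ?r * ?G\<^sup>2" using norm_ge_zero[of "noise_score X e n"] by (simp only: mult_1_right power_one)
  then show "?G \<le> noise_envelope X e n" using rest by (simp add: noise_envelope_def)
  have "1 * ?G\<^sup>2 \<le> ?r * ?G\<^sup>2" by (intro mult_right_mono r) auto
  then show "?G\<^sup>2 \<le> noise_envelope X e n" using rest unfolding noise_envelope_def by linarith
qed

lemma gram_form_add:
  "gram_form I X (u + d) = gram_form I X u + gram_form I X d
     + 2 * (\<Sum>i\<in>I. (X i \<bullet> u) * (X i \<bullet> d)) / real (card I)"
  by (simp add: gram_form_def inner_add_right power2_sum sum.distrib add_divide_distrib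
      sum_distrib_left mult.assoc)

text \<open>
  Stability against the problem without penalty, whose noiseless minimizer is \<open>\<theta>\<close>.
\<close>
lemma noiseless_lasso_error:
  fixes X :: "nat \<Rightarrow> real^'p"
  assumes c: "c > 0" and co: "\<And>v. c * (norm v)\<^sup>2 \<le> gram_form I X v" and l: "0 \<le> l" "l \<le> B"
  shows "norm (lasso I X (\<lambda>i. X i \<bullet> \<theta>) l - \<theta>) \<le> real CARD('p) * B / c"
proof -
  have "c * norm (lasso I X (\<lambda>i. X i \<bullet> \<theta>) l - \<theta>)
      \<le> norm (score I X (\<lambda>i. X i \<bullet> \<theta>) \<theta> - score I X (\<lambda>i. X i \<bullet> \<theta>) \<theta>) + real CARD('p) * \<bar>0 - l\<bar>"
    by (rule minimizer_stability[OF _ _ lasso_minimizes[OF c co l(1)] l(1) co])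
      (auto simp: lasso_objective_def intro!: divide_nonneg_nonneg sum_nonneg)
  also have "\<dots> \<le> real CARD('p) * B" using l by (simp add: mult_left_mono)
  finally show ?thesis using c by (simp add: field_simps)
qed

lemma abs_inner_le: "norm (x::'b::real_inner) \<le> b \<Longrightarrow> norm v \<le> k \<Longrightarrow> \<bar>x \<bullet> v\<bar> \<le> b * k"
  by (rule order_trans[OF Cauchy_Schwarz_ineq2])
    (auto intro!: mult_mono intro: order_trans[OF norm_ge_zero])

text \<open>
  The noise changes the gradient by exactly \<open>noise_score\<close>, so the lasso moves by at most
  \<open>norm (noise_score X e n) / c\<close>, and the prediction loss is quadratic in the estimator.
\<close>
lemma full_sample_approximation:
  fixes X :: "nat \<Rightarrow> real^'p"
  assumes n: "n \<ge> 1" and c: "c > 0" and co: "\<And>v. c * (norm v)\<^sup>2 \<le> gram_form {..<n} X v"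
    and b: "\<And>i. norm (X i) \<le> b" and l: "0 \<le> l" "l \<le> B"
  defines "K \<equiv> real CARD('p) * B / c"
  shows "\<bar>gram_form {..<n} X (lasso {..<n} X (\<lambda>i. X i \<bullet> \<theta> + e i) l - \<theta>)
          - gram_form {..<n} X (lasso {..<n} X (\<lambda>i. X i \<bullet> \<theta>) l - \<theta>)\<bar>
         \<le> (b\<^sup>2 / c\<^sup>2 + 2 * b\<^sup>2 * K / c) * noise_envelope X e n"
proof -
  define u where "u = lasso {..<n} X (\<lambda>i. X i \<bullet> \<theta>) l"
  define v where "v = lasso {..<n} X (\<lambda>i. X i \<bullet> \<theta> + e i) l"
  define d where "d = v - u"
  let ?G = "norm (noise_score X e n)"
  have b0: "b \<ge> 0" by (rule order_trans[OF norm_ge_zero b])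
  have K0: "K \<ge> 0" using c l by (simp add: K_def)
  have K: "norm (u - \<theta>) \<le> K" unfolding u_def K_def by (rule noiseless_lasso_error[OF c co l])
  have "c * norm (v - u) \<le> norm (score {..<n} X (\<lambda>i. X i \<bullet> \<theta>) u - score {..<n} X (\<lambda>i. X i \<bullet> \<theta> + e i) u)
      + real CARD('p) * \<bar>l - l\<bar>"
    unfolding u_def v_def by (intro minimizer_stability lasso_minimizes[OF c co] l co)
  also have "score {..<n} X (\<lambda>i. X i \<bullet> \<theta>) u - score {..<n} X (\<lambda>i. X i \<bullet> \<theta> + e i) u = - noise_score X e n"
    unfolding score_def noise_score_def
    by (simp add: algebra_simps sum.distrib sum_subtractf)
  finally have d: "norm d \<le> ?G / c" using c by (simp add: d_def field_simps)
  have gd: "gram_form {..<n} X d \<le> b\<^sup>2 * (?G / c)\<^sup>2"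
    by (rule order_trans[OF gram_form_le[of X b, OF b]]) (intro mult_left_mono power_mono d, auto)
  have gd0: "0 \<le> gram_form {..<n} X d" by (simp add: gram_form_def sum_nonneg)
  have cr: "\<bar>\<Sum>i<n. (X i \<bullet> (u - \<theta>)) * (X i \<bullet> d)\<bar> \<le> real n * ((b * K) * (b * (?G / c)))"
  proof -
    have "\<bar>\<Sum>i<n. (X i \<bullet> (u - \<theta>)) * (X i \<bullet> d)\<bar> \<le> (\<Sum>i<n. (b * K) * (b * (?G / c)))"
      by (rule order_trans[OF sum_abs sum_mono])
        (unfold abs_mult, intro mult_mono abs_inner_le b K d, use b0 K0 in auto)
    then show ?thesis by simp
  qed
  have "gram_form {..<n} X (v - \<theta>) - gram_form {..<n} X (u - \<theta>)
     = gram_form {..<n} X d + 2 * (\<Sum>i<n. (X i \<bullet> (u - \<theta>)) * (X i \<bullet> d)) / real n"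
    using gram_form_add[of "{..<n}" X "u - \<theta>" d] by (simp add: d_def)
  moreover have "\<bar>2 * (\<Sum>i<n. (X i \<bullet> (u - \<theta>)) * (X i \<bullet> d)) / real n\<bar> \<le> 2 * ((b * K) * (b * (?G / c)))"
  proof -
    have "\<bar>\<Sum>i<n. (X i \<bullet> (u - \<theta>)) * (X i \<bullet> d)\<bar> / real n \<le> (b * K) * (b * (?G / c))"
      using cr n by (simp add: divide_le_eq mult.commute)
    then show ?thesis by (simp add: abs_mult)
  qed
  ultimately have "\<bar>gram_form {..<n} X (v - \<theta>) - gram_form {..<n} X (u - \<theta>)\<bar>
      \<le> b\<^sup>2 * (?G / c)\<^sup>2 + 2 * ((b * K) * (b * (?G / c)))"
    using gd gd0 by linarith
  also have "\<dots> = b\<^sup>2 / c\<^sup>2 * ?G\<^sup>2 + 2 * b\<^sup>2 * K / c * ?G"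
    by (simp add: power2_eq_square)
  also have "\<dots> \<le> b\<^sup>2 / c\<^sup>2 * noise_envelope X e n + 2 * b\<^sup>2 * K / c * noise_envelope X e n"
    using K0 c by (intro add_mono mult_left_mono noise_score_le_envelope n) auto
  finally show ?thesis by (simp add: u_def v_def algebra_simps)
qed

text \<open>
  Compared with the noiseless gradient of the full sample, the gradient of the reduced sample
  contains the noise, lacks observation \<open>i\<close>, and is averaged over \<open>n - 1\<close> terms.  The noise
  contributes \<open>n / (n - 1) \<le> 2\<close> times \<open>noise_score\<close>; the other two effects are of order \<open>1/n\<close>,
  and observation \<open>i\<close> brings in its own noise \<open>e i\<close>.
\<close>
lemma leave_one_out_distance:
  fixes X :: "nat \<Rightarrow> real^'p"
  assumes n: "n \<ge> 2" and i: "i < n" and c: "c > 0"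
    and co: "\<And>v. c * (norm v)\<^sup>2 \<le> gram_form {..<n} X v"
    and coi: "\<And>v. c * (norm v)\<^sup>2 \<le> gram_form ({..<n} - {i}) X v"
    and b: "\<And>i. norm (X i) \<le> b" and l: "0 \<le> l" "l \<le> B"
  defines "K \<equiv> real CARD('p) * B / c"
  shows "norm (lasso ({..<n} - {i}) X (\<lambda>i. X i \<bullet> \<theta> + e i) l - lasso {..<n} X (\<lambda>i. X i \<bullet> \<theta>) l)
    \<le> (2 * norm (noise_score X e n) + (4 * b\<^sup>2 * K + 2 * b * \<bar>e i\<bar>) / real n) / c"
proof -
  let ?J = "{..<n} - {i}"
  define u where "u = lasso {..<n} X (\<lambda>i. X i \<bullet> \<theta>) l"
  define v where "v = lasso ?J X (\<lambda>i. X i \<bullet> \<theta> + e i) l"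
  define a where "a j = X j \<bullet> (\<theta> - u)" for j
  define s where "s = (\<Sum>j<n. a j *\<^sub>R X j)"
  define g where "g = noise_score X e n"
  let ?N = "real n"
  have N: "?N \<ge> 2" using n by simp
  have b0: "b \<ge> 0" by (rule order_trans[OF norm_ge_zero b])
  have K: "norm (\<theta> - u) \<le> K"
    using noiseless_lasso_error[OF c co l, of \<theta>] by (simp add: u_def K_def norm_minus_commute)
  have a: "\<bar>a j\<bar> \<le> b * K" for j unfolding a_def by (intro abs_inner_le b K)
  have "norm s \<le> (\<Sum>j<n. (b * K) * b)"
    unfolding s_def by (rule sum_norm_le) (use a b in \<open>auto intro!: mult_mono order_trans[OF abs_ge_zero a]\<close>)
  then have s: "norm s \<le> ?N * (b\<^sup>2 * K)" by (simp add: power2_eq_square mult_ac)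
  have card: "card ?J = n - 1" using i by simp
  have ng: "(\<Sum>j<n. e j *\<^sub>R X j) = ?N *\<^sub>R g" using n by (simp add: g_def noise_score_def)
  have sJ: "score ?J X (\<lambda>i. X i \<bullet> \<theta> + e i) u = (1 / (?N - 1)) *\<^sub>R (s + ?N *\<^sub>R g - (a i + e i) *\<^sub>R X i)"
  proof -
    have "(\<Sum>j\<in>?J. (X j \<bullet> \<theta> + e j - X j \<bullet> u) *\<^sub>R X j)
        = (\<Sum>j<n. (a j + e j) *\<^sub>R X j) - (a i + e i) *\<^sub>R X i"
      using i by (subst sum_diff) (auto simp: a_def inner_diff_right algebra_simps)
    also have "(\<Sum>j<n. (a j + e j) *\<^sub>R X j) = s + ?N *\<^sub>R g"
      by (simp add: s_def scaleR_add_left sum.distrib ng)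
    finally show ?thesis unfolding score_def card using n by (simp add: of_nat_diff)
  qed
  have sI: "score {..<n} X (\<lambda>i. X i \<bullet> \<theta>) u = (1 / ?N) *\<^sub>R s"
    unfolding score_def s_def a_def by (simp add: inner_diff_right)
  have "(1 / ?N) *\<^sub>R s - (1 / (?N - 1)) *\<^sub>R (s + ?N *\<^sub>R g - (a i + e i) *\<^sub>R X i)
      = - (1 / (?N * (?N - 1))) *\<^sub>R s - (?N / (?N - 1)) *\<^sub>R g + ((a i + e i) / (?N - 1)) *\<^sub>R X i"
  proof -
    have "1 / ?N - 1 / (?N - 1) = - (1 / (?N * (?N - 1)))" using N by (simp add: field_simps)
    then have "(1 / ?N) *\<^sub>R s - (1 / (?N - 1)) *\<^sub>R s = - (1 / (?N * (?N - 1))) *\<^sub>R s"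
      by (metis scaleR_diff_left)
    then show ?thesis by (simp add: scaleR_diff_right scaleR_add_right)
  qed
  also have "norm \<dots> \<le> norm s / (?N * (?N - 1)) + ?N / (?N - 1) * norm g + \<bar>a i + e i\<bar> / (?N - 1) * norm (X i)"
    using N by (intro order_trans[OF norm_triangle_ineq] order_trans[OF norm_triangle_ineq4] add_mono) auto
  also have "\<dots> \<le> (b\<^sup>2 * K) * (2 / ?N) + 2 * norm g + (b * K + \<bar>e i\<bar>) * (2 / ?N) * b"
  proof (intro add_mono)
    have h: "1 / (?N - 1) \<le> 2 / ?N" using N by (simp add: field_simps)
    have bK: "0 \<le> b\<^sup>2 * K" using s order_trans[OF norm_ge_zero s] N by (simp add: zero_le_mult_iff)
    have "norm s / (?N * (?N - 1)) \<le> (?N * (b\<^sup>2 * K)) / (?N * (?N - 1))"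
      using N by (intro divide_right_mono s) auto
    also have "\<dots> = (b\<^sup>2 * K) * (1 / (?N - 1))" using N by simp
    also have "\<dots> \<le> (b\<^sup>2 * K) * (2 / ?N)" by (rule mult_left_mono[OF h bK])
    finally show "norm s / (?N * (?N - 1)) \<le> (b\<^sup>2 * K) * (2 / ?N)" .
    show "?N / (?N - 1) * norm g \<le> 2 * norm g" using N by (intro mult_right_mono) (auto simp: field_simps)
    have "\<bar>a i + e i\<bar> * (1 / (?N - 1)) * norm (X i) \<le> (b * K + \<bar>e i\<bar>) * (2 / ?N) * b"
      using a[of i] N b0 by (intro mult_mono h b) (auto intro: add_nonneg_nonneg order_trans[OF abs_ge_zero a])
    then show "\<bar>a i + e i\<bar> / (?N - 1) * norm (X i) \<le> (b * K + \<bar>e i\<bar>) * (2 / ?N) * b" by simp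
  qed
  also have "\<dots> = 2 * norm g + (4 * b\<^sup>2 * K + 2 * b * \<bar>e i\<bar>) / ?N"
    using N by (simp add: power2_eq_square field_simps)
  finally have "norm (score {..<n} X (\<lambda>i. X i \<bullet> \<theta>) u - score ?J X (\<lambda>i. X i \<bullet> \<theta> + e i) u)
      \<le> 2 * norm g + (4 * b\<^sup>2 * K + 2 * b * \<bar>e i\<bar>) / ?N"
    unfolding sI sJ .
  moreover have "c * norm (v - u) \<le> norm (score {..<n} X (\<lambda>i. X i \<bullet> \<theta>) u - score ?J X (\<lambda>i. X i \<bullet> \<theta> + e i) u)
      + real CARD('p) * \<bar>l - l\<bar>"
    unfolding u_def v_def
    by (intro minimizer_stability lasso_minimizes[OF c co] lasso_minimizes[OF c coi] l coi)
  ultimately have "c * norm (v - u) \<le> 2 * norm g + (4 * b\<^sup>2 * K + 2 * b * \<bar>e i\<bar>) / ?N" by simp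
  then show ?thesis using c by (simp add: u_def v_def g_def pos_le_divide_eq mult.commute)
qed

text \<open>
  The leave-one-out residual is \<open>e i + a i - X i \<bullet> d i\<close>, where \<open>a i\<close> is the noiseless
  prediction error and \<open>d i\<close> the displacement of the estimator.  The squares of \<open>e i\<close> and
  \<open>a i\<close> give the two subtracted averages, and the mean of their products is
  \<open>noise_score X e n \<bullet> (\<theta> - u)\<close>, which is small although the single products are not.  All terms
  with \<open>d i\<close> are errors and are bounded one by one.
\<close>
lemma cross_validation_approximation:
  fixes X :: "nat \<Rightarrow> real^'p"
  assumes n: "n \<ge> 2" and c: "c > 0" and co: "\<And>v. c * (norm v)\<^sup>2 \<le> gram_form {..<n} X v"
    and coi: "\<And>i v. i < n \<Longrightarrow> c * (norm v)\<^sup>2 \<le> gram_form ({..<n} - {i}) X v"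
    and b: "\<And>i. norm (X i) \<le> b" and l: "0 \<le> l" "l \<le> B"
  defines "K \<equiv> real CARD('p) * B / c"
  defines "\<kappa> \<equiv> 2 * b + 2 * b^3 * K\<^sup>2 + (b + b\<^sup>2) / c\<^sup>2 * (8 + 64 * b^4 * K\<^sup>2 + 16 * b\<^sup>2)"
  shows "\<bar>loocv_risk X (\<lambda>i. X i \<bullet> \<theta> + e i) n l - (\<Sum>i<n. (e i)\<^sup>2) / real n
          - gram_form {..<n} X (lasso {..<n} X (\<lambda>i. X i \<bullet> \<theta>) l - \<theta>)\<bar>
         \<le> (\<kappa> + 2 * K) * noise_envelope X e n"
proof -
  define u where "u = lasso {..<n} X (\<lambda>i. X i \<bullet> \<theta>) l"
  define d where "d i = lasso ({..<n} - {i}) X (\<lambda>i. X i \<bullet> \<theta> + e i) l - u" for i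
  define a where "a j = X j \<bullet> (\<theta> - u)" for j
  define g where "g = noise_score X e n"
  let ?N = "real n" and ?r = "sqrt (real n)" and ?G = "norm g"
  have N: "?N \<ge> 2" using n by simp
  have r: "?r \<ge> 1" using n by simp
  have b0: "b \<ge> 0" by (rule order_trans[OF norm_ge_zero b])
  have K0: "K \<ge> 0" using c l by (simp add: K_def)
  have K: "norm (\<theta> - u) \<le> K"
    using noiseless_lasso_error[OF c co l, of \<theta>] by (simp add: u_def K_def norm_minus_commute)
  have a: "\<bar>a j\<bar> \<le> b * K" for j unfolding a_def by (intro abs_inner_le b K)
  define D where "D i = (2 * ?G + (4 * b\<^sup>2 * K + 2 * b * \<bar>e i\<bar>) / ?N) / c" for i
  have d: "norm (d i) \<le> D i" if "i < n" for i
    unfolding d_def D_def u_def g_def K_def by (rule leave_one_out_distance[OF n that c co coi b l]) (rule that)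
  define t where "t i = (X i \<bullet> d i)\<^sup>2 - 2 * (e i + a i) * (X i \<bullet> d i)" for i
  have t: "\<bar>t i\<bar> \<le> \<kappa> * (1 / ?r + ?r * ?G\<^sup>2 + (e i)\<^sup>2 / ?r)" if i: "i < n" for i
  proof -
    let ?x = "\<bar>e i\<bar>"
    have Xd: "\<bar>X i \<bullet> d i\<bar> \<le> b * D i" by (intro abs_inner_le b d i)
    have "\<bar>t i\<bar> \<le> \<bar>X i \<bullet> d i\<bar>\<^sup>2 + 2 * \<bar>e i + a i\<bar> * \<bar>X i \<bullet> d i\<bar>"
      unfolding t_def using abs_triangle_ineq4[of "(X i \<bullet> d i)\<^sup>2" "2 * (e i + a i) * (X i \<bullet> d i)"]
      by (simp only: abs_mult abs_power2 power2_abs abs_numeral)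
    also have "\<dots> \<le> (b * D i)\<^sup>2 + 2 * (?x + b * K) * (b * D i)"
      using a[of i] Xd b0 K0 by (intro add_mono power_mono mult_mono) auto
    also have "\<dots> = b\<^sup>2 * (D i)\<^sup>2 + b * (2 * D i * (?x + b * K))"
      by (simp add: power2_eq_square algebra_simps)
    \<comment> \<open>Young's inequality with weight \<open>sqrt n\<close>, as \<open>D i\<close> is of order \<open>1 / sqrt n\<close>.\<close>
    also have "\<dots> \<le> b\<^sup>2 * (?r * (D i)\<^sup>2) + b * ((?x + b * K)\<^sup>2 / ?r + ?r * (D i)\<^sup>2)"
      using r b0 by (intro add_mono mult_left_mono le_weighted_square)
        (auto intro: order_trans[OF _ mult_right_mono[OF r]])
    also have "\<dots> = b * ((?x + b * K)\<^sup>2 / ?r) + (b + b\<^sup>2) * (?r * (D i)\<^sup>2)"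
      by (simp add: algebra_simps)
    also have "\<dots> \<le> b * ((2 * (e i)\<^sup>2 + 2 * (b * K)\<^sup>2) / ?r)
        + (b + b\<^sup>2) * ((8 * (?r * ?G\<^sup>2) + 4 * ((4 * b\<^sup>2 * K)\<^sup>2 + (2 * b)\<^sup>2 * (e i)\<^sup>2) / ?r) / c\<^sup>2)"
    proof (intro add_mono mult_left_mono divide_right_mono)
      have sq: "(x + y)\<^sup>2 \<le> 2 * x\<^sup>2 + 2 * y\<^sup>2" for x y :: real
        using zero_le_power2[of "x - y"] by (simp add: power2_eq_square algebra_simps)
      show "(?x + b * K)\<^sup>2 \<le> 2 * (e i)\<^sup>2 + 2 * (b * K)\<^sup>2" using sq[of ?x "b * K"] by simp
      have "(D i)\<^sup>2 = (2 * ?G + (4 * b\<^sup>2 * K + 2 * b * ?x) / ?N)\<^sup>2 / c\<^sup>2" by (simp add: D_def power_divide)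
      also have "\<dots> \<le> (8 * ?G\<^sup>2 + 4 * ((4 * b\<^sup>2 * K)\<^sup>2 + (2 * b)\<^sup>2 * (e i)\<^sup>2) / ?N\<^sup>2) / c\<^sup>2"
      proof (rule divide_right_mono)
        have "2 * (4 * b\<^sup>2 * K + 2 * b * ?x)\<^sup>2 \<le> 4 * ((4 * b\<^sup>2 * K)\<^sup>2 + (2 * b)\<^sup>2 * (e i)\<^sup>2)"
          using sq[of "4 * b\<^sup>2 * K" "2 * b * ?x"] by (simp add: power_mult_distrib)
        then have "2 * (4 * b\<^sup>2 * K + 2 * b * ?x)\<^sup>2 / ?N\<^sup>2 \<le> 4 * ((4 * b\<^sup>2 * K)\<^sup>2 + (2 * b)\<^sup>2 * (e i)\<^sup>2) / ?N\<^sup>2"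
          by (rule divide_right_mono) simp
        then show "(2 * ?G + (4 * b\<^sup>2 * K + 2 * b * ?x) / ?N)\<^sup>2
            \<le> 8 * ?G\<^sup>2 + 4 * ((4 * b\<^sup>2 * K)\<^sup>2 + (2 * b)\<^sup>2 * (e i)\<^sup>2) / ?N\<^sup>2"
          using sq[of "2 * ?G" "(4 * b\<^sup>2 * K + 2 * b * ?x) / ?N"] by (simp add: power_divide)
      qed simp
      finally have "?r * (D i)\<^sup>2 \<le> ?r * ((8 * ?G\<^sup>2 + 4 * ((4 * b\<^sup>2 * K)\<^sup>2 + (2 * b)\<^sup>2 * (e i)\<^sup>2) / ?N\<^sup>2) / c\<^sup>2)"
        using r by (intro mult_left_mono) auto
      also have "\<dots> = (8 * (?r * ?G\<^sup>2) + 4 * ((4 * b\<^sup>2 * K)\<^sup>2 + (2 * b)\<^sup>2 * (e i)\<^sup>2) * (?r / ?N\<^sup>2)) / c\<^sup>2"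
      proof -
        have "?r * ((8 * G + 4 * s / m) / k) = (8 * (?r * G) + 4 * s * (?r / m)) / k" for G s m k :: real
          by (simp add: algebra_simps)
        then show ?thesis .
      qed
      also have "\<dots> \<le> (8 * (?r * ?G\<^sup>2) + 4 * ((4 * b\<^sup>2 * K)\<^sup>2 + (2 * b)\<^sup>2 * (e i)\<^sup>2) * (1 / ?r)) / c\<^sup>2"
      proof (intro divide_right_mono add_left_mono mult_left_mono)
        have "?r * ?r \<le> ?N\<^sup>2" using N by (simp add: power2_eq_square)
        then show "?r / ?N\<^sup>2 \<le> 1 / ?r" using r N by (simp add: field_simps)
      qed auto
      finally show "?r * (D i)\<^sup>2 \<le> (8 * (?r * ?G\<^sup>2) + 4 * ((4 * b\<^sup>2 * K)\<^sup>2 + (2 * b)\<^sup>2 * (e i)\<^sup>2) / ?r) / c\<^sup>2"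
        by simp
    qed (use b0 r in auto)
    also have "\<dots> = (2 * b + (b + b\<^sup>2) / c\<^sup>2 * (16 * b\<^sup>2)) * ((e i)\<^sup>2 / ?r)
        + (2 * b^3 * K\<^sup>2 + (b + b\<^sup>2) / c\<^sup>2 * (64 * b^4 * K\<^sup>2)) * (1 / ?r)
        + (b + b\<^sup>2) / c\<^sup>2 * 8 * (?r * ?G\<^sup>2)"
    proof -
      have "b * ((2 * p + 2 * (b * K)\<^sup>2) * q) + (b + b\<^sup>2) * ((8 * z + 4 * ((4 * b\<^sup>2 * K)\<^sup>2 + (2 * b)\<^sup>2 * p) * q) * k)
          = (2 * b + (b + b\<^sup>2) * k * (16 * b\<^sup>2)) * (p * q)
          + (2 * b^3 * K\<^sup>2 + (b + b\<^sup>2) * k * (64 * b^4 * K\<^sup>2)) * q + (b + b\<^sup>2) * k * 8 * z" for p q z k :: real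
        by algebra
      from this[of "(e i)\<^sup>2" "1 / ?r" "?r * ?G\<^sup>2" "1 / c\<^sup>2"]
      show ?thesis by (simp only: times_divide_eq_right mult_1_right)
    qed
    also have "\<dots> \<le> \<kappa> * ((e i)\<^sup>2 / ?r) + \<kappa> * (1 / ?r) + \<kappa> * (?r * ?G\<^sup>2)"
    proof -
      define D where "D = (b + b\<^sup>2) / c\<^sup>2"
      have "D \<ge> 0" using b0 by (simp add: D_def)
      then have "0 \<le> D * 8" "0 \<le> D * (64 * b^4 * K\<^sup>2)" "0 \<le> D * (16 * b\<^sup>2)" by auto
      moreover have "0 \<le> 2 * b^3 * K\<^sup>2" using b0 by simp
      moreover have "\<kappa> = 2 * b + 2 * b^3 * K\<^sup>2 + (D * 8 + D * (64 * b^4 * K\<^sup>2) + D * (16 * b\<^sup>2))"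
        unfolding \<kappa>_def D_def by (simp only: distrib_left)
      ultimately have "2 * b + D * (16 * b\<^sup>2) \<le> \<kappa>" "2 * b^3 * K\<^sup>2 + D * (64 * b^4 * K\<^sup>2) \<le> \<kappa>" "D * 8 \<le> \<kappa>"
        using b0 by linarith+
      then show ?thesis unfolding D_def by (intro add_mono mult_right_mono) (use r in auto)
    qed
    finally show ?thesis by (simp add: algebra_simps)
  qed
  have "(\<Sum>i<n. (X i \<bullet> \<theta> + e i - X i \<bullet> lasso ({..<n} - {i}) X (\<lambda>i. X i \<bullet> \<theta> + e i) l)\<^sup>2)
     = (\<Sum>i<n. (e i)\<^sup>2 + (X i \<bullet> (u - \<theta>))\<^sup>2 + 2 * (e i * (X i \<bullet> (\<theta> - u))) + t i)"
  proof (rule sum.cong[OF refl])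
    fix i
    have res: "X i \<bullet> \<theta> + e i - X i \<bullet> lasso ({..<n} - {i}) X (\<lambda>i. X i \<bullet> \<theta> + e i) l = e i + a i - X i \<bullet> d i"
      by (simp add: a_def d_def inner_diff_right)
    have neg: "X i \<bullet> (u - \<theta>) = - a i" by (simp add: a_def inner_diff_right)
    show "(X i \<bullet> \<theta> + e i - X i \<bullet> lasso ({..<n} - {i}) X (\<lambda>i. X i \<bullet> \<theta> + e i) l)\<^sup>2
      = (e i)\<^sup>2 + (X i \<bullet> (u - \<theta>))\<^sup>2 + 2 * (e i * (X i \<bullet> (\<theta> - u))) + t i"
      unfolding res neg t_def a_def[symmetric] by (simp add: power2_eq_square algebra_simps)
  qed
  also have "\<dots> = (\<Sum>i<n. (e i)\<^sup>2) + (\<Sum>i<n. (X i \<bullet> (u - \<theta>))\<^sup>2)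
      + 2 * (\<Sum>i<n. e i * (X i \<bullet> (\<theta> - u))) + (\<Sum>i<n. t i)"
    by (simp add: sum.distrib sum_distrib_left)
  also have "(\<Sum>i<n. e i * (X i \<bullet> (\<theta> - u))) = ?N * (g \<bullet> (\<theta> - u))"
    using n by (simp add: g_def noise_score_def inner_sum_left)
  finally have eq: "loocv_risk X (\<lambda>i. X i \<bullet> \<theta> + e i) n l - (\<Sum>i<n. (e i)\<^sup>2) / ?N - gram_form {..<n} X (u - \<theta>)
      = 2 * (g \<bullet> (\<theta> - u)) + (\<Sum>i<n. t i) / ?N"
    unfolding loocv_risk_def gram_form_def using n by (simp add: field_simps)
  have "\<bar>\<Sum>i<n. t i\<bar> \<le> (\<Sum>i<n. \<kappa> * (1 / ?r + ?r * ?G\<^sup>2 + (e i)\<^sup>2 / ?r))"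
    by (rule order_trans[OF sum_abs sum_mono]) (use t in auto)
  also have "\<dots> = ?N * (\<kappa> * noise_envelope X e n)"
    using n by (simp add: noise_envelope_def g_def sum.distrib sum_distrib_left[symmetric]
        sum_divide_distrib[symmetric] distrib_left)
  finally have "\<bar>(\<Sum>i<n. t i) / ?N\<bar> \<le> \<kappa> * noise_envelope X e n" using N by (simp add: field_simps)
  moreover have "\<bar>2 * (g \<bullet> (\<theta> - u))\<bar> \<le> 2 * K * noise_envelope X e n"
  proof -
    have "\<bar>g \<bullet> (\<theta> - u)\<bar> \<le> noise_envelope X e n * K"
      using n by (intro abs_inner_le K) (simp add: g_def noise_score_le_envelope)
    then show ?thesis by (simp add: abs_mult mult_ac)
  qed
  ultimately show ?thesis unfolding u_def[symmetric] eq distrib_right by linarith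
qed

section \<open>Conditioning of the design\<close>

lemma gram_form_eq_sample_gram: "gram_form {..<n} X v = v \<bullet> (sample_gram X n *v v)"
proof -
  have "outer x *v v = (x \<bullet> v) *\<^sub>R x" for x :: "real^'a"
    by (simp add: vec_eq_iff outer_def matrix_vector_mult_def inner_vec_def sum_distrib_left sum_distrib_right mult_ac)
  moreover have "(\<Sum>i<n. outer (X i)) *v v = (\<Sum>i<n. outer (X i) *v v)"
    by (induction n) (simp_all add: matrix_vector_mult_add_rdistrib)
  ultimately have "sample_gram X n *v v = (1 / real n) *\<^sub>R (\<Sum>i<n. (X i \<bullet> v) *\<^sub>R X i)"
    by (simp add: sample_gram_def flip: scaleR_matrix_vector_assoc)
  then show ?thesis
    by (simp add: gram_form_def inner_sum_right power2_eq_square inner_commute)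
qed

lemma abs_quadratic_form_le:
  fixes D :: "real^'p^'p"
  shows "\<bar>v \<bullet> (D *v v)\<bar> \<le> (real CARD('p))\<^sup>2 * norm D * (norm v)\<^sup>2"
proof -
  have "v \<bullet> (D *v v) = (\<Sum>a\<in>UNIV. \<Sum>b\<in>UNIV. v $ a * (D $ a $ b * v $ b))"
    by (simp add: inner_vec_def matrix_vector_mult_def sum_distrib_left)
  also have "\<bar>\<dots>\<bar> \<le> (\<Sum>a\<in>(UNIV::'p set). \<Sum>b\<in>(UNIV::'p set). norm v * (norm D * norm v))"
  proof (intro order_trans[OF sum_abs sum_mono] order_trans[OF sum_abs sum_mono])
    fix a b
    have "\<bar>D $ a $ b\<bar> \<le> norm D"
      by (rule order_trans[OF component_le_norm_cart Finite_Cartesian_Product.norm_nth_le])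
    then show "\<bar>v $ a * (D $ a $ b * v $ b)\<bar> \<le> norm v * (norm D * norm v)"
      unfolding abs_mult by (intro mult_mono component_le_norm_cart) auto
  qed
  finally show ?thesis by (simp add: power2_eq_square mult_ac)
qed

text \<open>
  The constant is the minimum of the quadratic form over the compact unit sphere.
\<close>
lemma pos_def_matrix_coercive:
  fixes C :: "real^'p^'p"
  assumes "pos_def_matrix C"
  obtains c where "c > 0" "\<And>v. c * (norm v)\<^sup>2 \<le> v \<bullet> (C *v v)"
proof -
  have cont: "continuous_on (sphere 0 1) (\<lambda>v :: real^'p. v \<bullet> (C *v v))"
    by (intro continuous_intros matrix_vector_mult_linear_continuous_on)
  have ne: "sphere (0::real^'p) 1 \<noteq> {}" by simp
  obtain w where w: "w \<in> sphere 0 1" "\<And>v. v \<in> sphere 0 1 \<Longrightarrow> w \<bullet> (C *v w) \<le> v \<bullet> (C *v v)"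
    using continuous_attains_inf[OF compact_sphere ne cont] by blast
  have "(w \<bullet> (C *v w)) * (norm v)\<^sup>2 \<le> v \<bullet> (C *v v)" for v
  proof (cases "v = 0")
    case False
    define s where "s = (1 / norm v) *\<^sub>R v"
    have "norm s = 1" and v: "v = norm v *\<^sub>R s" using False by (auto simp: s_def)
    then have le: "w \<bullet> (C *v w) \<le> s \<bullet> (C *v s)" using w(2)[of s] by simp
    have "(k *\<^sub>R s) \<bullet> (C *v (k *\<^sub>R s)) = (s \<bullet> (C *v s)) * k\<^sup>2" for k
      by (simp add: matrix_vector_mult_scaleR power2_eq_square)
    from this[of "norm v"] have "v \<bullet> (C *v v) = (s \<bullet> (C *v s)) * (norm v)\<^sup>2"
      unfolding v[symmetric] .
    then show ?thesis using le by (simp add: mult_right_mono)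
  qed simp
  moreover have "w \<noteq> 0" using w(1) by auto
  then have "w \<bullet> (C *v w) > 0" using assms by (simp add: pos_def_matrix_def)
  ultimately show ?thesis by (rule that[rotated])
qed

text \<open>
  The coercivity of the limit matrix passes to the sample Gram matrices by convergence.  Deleting
  one row of norm at most \<open>b\<close> costs only \<open>O(1/n)\<close>, so one constant serves all reduced designs
  as well.  Of the limiting constant \<open>c0\<close>, convergence uses up one quarter and the
  deletion another.
\<close>
lemma eventually_gram_form_coercive:
  fixes X :: "nat \<Rightarrow> real^'p"
  assumes lim: "(\<lambda>n. sample_gram X n) \<longlonglongrightarrow> C" and pd: "pos_def_matrix C"
    and b: "\<And>i. norm (X i) \<le> b"
  obtains c where "c > 0"
    "\<forall>\<^sub>F n in sequentially. (\<forall>v. c * (norm v)\<^sup>2 \<le> gram_form {..<n} X v) \<and>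
       (\<forall>i<n. \<forall>v. c * (norm v)\<^sup>2 \<le> gram_form ({..<n} - {i}) X v)"
proof -
  obtain c0 where c0: "c0 > 0" and C: "\<And>v. c0 * (norm v)\<^sup>2 \<le> v \<bullet> (C *v v)"
    using pos_def_matrix_coercive[OF pd] by blast
  have "(\<lambda>n. (real CARD('p))\<^sup>2 * norm (sample_gram X n - C)) \<longlonglongrightarrow> (real CARD('p))\<^sup>2 * norm (C - C)"
    by (intro tendsto_intros lim)
  then have e1: "\<forall>\<^sub>F n in sequentially. (real CARD('p))\<^sup>2 * norm (sample_gram X n - C) < c0 / 4"
    by (rule order_tendstoD(2)) (use c0 in simp)
  have "(\<lambda>n. b\<^sup>2 * inverse (real n)) \<longlonglongrightarrow> b\<^sup>2 * 0" by (intro tendsto_intros lim_inverse_n)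
  then have e2: "\<forall>\<^sub>F n in sequentially. b\<^sup>2 * inverse (real n) < c0 / 8"
    by (rule order_tendstoD(2)) (use c0 in simp)
  have "\<forall>\<^sub>F n in sequentially. (\<forall>v. (c0 / 2) * (norm v)\<^sup>2 \<le> gram_form {..<n} X v) \<and>
       (\<forall>i<n. \<forall>v. (c0 / 2) * (norm v)\<^sup>2 \<le> gram_form ({..<n} - {i}) X v)"
    using e1 e2 eventually_ge_at_top[of 2]
  proof eventually_elim
    case (elim n)
    have full: "(3 * c0 / 4) * (norm v)\<^sup>2 \<le> gram_form {..<n} X v" for v
    proof -
      have "\<bar>v \<bullet> ((sample_gram X n - C) *v v)\<bar> \<le> c0 / 4 * (norm v)\<^sup>2"
        by (rule order_trans[OF abs_quadratic_form_le mult_right_mono]) (use elim in auto)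
      moreover have "v \<bullet> (sample_gram X n *v v) = v \<bullet> (C *v v) + v \<bullet> ((sample_gram X n - C) *v v)"
        by (simp add: matrix_vector_mult_diff_rdistrib inner_diff_right)
      ultimately show ?thesis using C[of v] unfolding gram_form_eq_sample_gram by linarith
    qed
    have loo: "(c0 / 2) * (norm v)\<^sup>2 \<le> gram_form ({..<n} - {i}) X v" if i: "i < n" for i v
    proof -
      let ?S = "\<Sum>j<n. (X j \<bullet> v)\<^sup>2"
      have "(X i \<bullet> v)\<^sup>2 = gram_form {i} X v" by (simp add: gram_form_def)
      also have "\<dots> \<le> b\<^sup>2 * (norm v)\<^sup>2" by (rule gram_form_le[OF b])
      also have "\<dots> \<le> (real n * (c0 / 8)) * (norm v)\<^sup>2"
        using elim by (intro mult_right_mono) (auto simp: field_simps)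
      finally have Xi: "(X i \<bullet> v)\<^sup>2 \<le> real n * (c0 / 8) * (norm v)\<^sup>2" .
      have S: "(3 * c0 / 4) * (norm v)\<^sup>2 * real n \<le> ?S"
        using full[of v] elim by (simp add: gram_form_def field_simps)
      have "(c0 / 2) * (norm v)\<^sup>2 * (real n - 1) \<le> (c0 / 2) * (norm v)\<^sup>2 * real n"
        using c0 by (intro mult_left_mono) auto
      also have "\<dots> = (3 * c0 / 4) * (norm v)\<^sup>2 * real n - 2 * (real n * (c0 / 8) * (norm v)\<^sup>2)"
        by (simp add: algebra_simps)
      also have "\<dots> \<le> ?S - (X i \<bullet> v)\<^sup>2"
        using S Xi zero_le_power2[of "X i \<bullet> v"] by linarith
      also have "\<dots> = (\<Sum>j\<in>{..<n} - {i}. (X j \<bullet> v)\<^sup>2)"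
        using i by (subst sum_diff) auto
      finally show ?thesis
        using i elim by (simp add: gram_form_def of_nat_diff pos_le_divide_eq)
    qed
    have half: "(c0 / 2) * (norm v)\<^sup>2 \<le> gram_form {..<n} X v" for v
      by (rule order_trans[OF mult_right_mono full]) (use c0 in auto)
    show ?case using half loo by blast
  qed
  then show ?thesis using c0 by (intro that[of "c0 / 2"]) auto
qed

section \<open>From the approximations to the risks\<close>

lemma (in prob_space) expected_noise_envelope:
  fixes X :: "nat \<Rightarrow> real^'p"
  assumes ind: "indep_vars (\<lambda>_. borel) W UNIV"
    and i1: "\<And>i. integrable M (W i)" and i2: "\<And>i. integrable M (\<lambda>\<omega>. (W i \<omega>)\<^sup>2)"
    and z: "\<And>i. (\<integral>\<omega>. W i \<omega> \<partial>M) = 0" and v: "\<And>i. (\<integral>\<omega>. (W i \<omega>)\<^sup>2 \<partial>M) \<le> K"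
    and B: "\<And>i. norm (X i) \<le> b" and n: "n \<ge> 1"
  shows "integrable M (\<lambda>\<omega>. noise_envelope X (\<lambda>i. \<sigma> * W i \<omega>) n)"
    and "(\<integral>\<omega>. noise_envelope X (\<lambda>i. \<sigma> * W i \<omega>) n \<partial>M) \<le> (1 + \<sigma>\<^sup>2 * K * b\<^sup>2 + \<sigma>\<^sup>2 * K) / sqrt n"
proof -
  let ?r = "sqrt (real n)" and ?N = "real n"
  have r: "?r > 0" "?r * ?r = ?N" using n by auto
  let ?S = "\<lambda>\<omega>. (norm (\<Sum>i<n. W i \<omega> *\<^sub>R X i))\<^sup>2"
  note S = expectation_norm_sum_le[OF ind i1 i2 z v B, where n = n]
  have eq: "noise_envelope X (\<lambda>i. \<sigma> * W i \<omega>) n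
     = 1 / ?r + \<sigma>\<^sup>2 * ?r / ?N\<^sup>2 * ?S \<omega> + \<sigma>\<^sup>2 / ?N / ?r * (\<Sum>i<n. (W i \<omega>)\<^sup>2)" for \<omega>
  proof -
    have "noise_score X (\<lambda>i. \<sigma> * W i \<omega>) n = (\<sigma> / ?N) *\<^sub>R (\<Sum>i<n. W i \<omega> *\<^sub>R X i)"
      by (simp add: noise_score_def scaleR_sum_right)
    then have "(norm (noise_score X (\<lambda>i. \<sigma> * W i \<omega>) n))\<^sup>2 = \<sigma>\<^sup>2 / ?N\<^sup>2 * ?S \<omega>"
      by (simp add: power_mult_distrib power_divide)
    then show ?thesis
      by (simp add: noise_envelope_def power_mult_distrib sum_distrib_left[symmetric])
  qed
  have isum: "integrable M (\<lambda>\<omega>. \<Sum>i<n. (W i \<omega>)\<^sup>2)" by (intro Bochner_Integration.integrable_sum i2)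
  show "integrable M (\<lambda>\<omega>. noise_envelope X (\<lambda>i. \<sigma> * W i \<omega>) n)"
    unfolding eq by (intro Bochner_Integration.integrable_add integrable_mult_right S(1) isum) auto
  have "(\<integral>\<omega>. noise_envelope X (\<lambda>i. \<sigma> * W i \<omega>) n \<partial>M)
      = 1 / ?r + \<sigma>\<^sup>2 * ?r / ?N\<^sup>2 * (\<integral>\<omega>. ?S \<omega> \<partial>M) + \<sigma>\<^sup>2 / ?N / ?r * (\<Sum>i<n. \<integral>\<omega>. (W i \<omega>)\<^sup>2 \<partial>M)"
    unfolding eq using S(1) isum i2 by (simp add: prob_space Bochner_Integration.integral_sum)
  also have "\<dots> \<le> 1 / ?r + \<sigma>\<^sup>2 * ?r / ?N\<^sup>2 * (?N * (K * b\<^sup>2)) + \<sigma>\<^sup>2 / ?N / ?r * (?N * K)"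
  proof (intro add_mono mult_left_mono S(2))
    show "(\<Sum>i<n. \<integral>\<omega>. (W i \<omega>)\<^sup>2 \<partial>M) \<le> ?N * K"
      using sum_bounded_above[of "{..<n}" "\<lambda>i. \<integral>\<omega>. (W i \<omega>)\<^sup>2 \<partial>M" K] v by simp
  qed auto
  also have "\<dots> = (1 + \<sigma>\<^sup>2 * K * b\<^sup>2 + \<sigma>\<^sup>2 * K) / ?r"
  proof -
    have *: "?r / ?N\<^sup>2 * ?N = 1 / ?r" using r n by (simp add: power2_eq_square field_simps)
    have "\<sigma>\<^sup>2 * ?r / ?N\<^sup>2 * (?N * (K * b\<^sup>2)) = \<sigma>\<^sup>2 * K * b\<^sup>2 * (?r / ?N\<^sup>2 * ?N)" by simp
    then have "\<sigma>\<^sup>2 * ?r / ?N\<^sup>2 * (?N * (K * b\<^sup>2)) = \<sigma>\<^sup>2 * K * b\<^sup>2 / ?r" unfolding * by simp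
    then show ?thesis using n by (simp add: add_divide_distrib)
  qed
  finally show "(\<integral>\<omega>. noise_envelope X (\<lambda>i. \<sigma> * W i \<omega>) n \<partial>M) \<le> (1 + \<sigma>\<^sup>2 * K * b\<^sup>2 + \<sigma>\<^sup>2 * K) / ?r" .
qed

text \<open>
  Selection by a criterion that tracks a deterministic \<open>ideal\<close> loss up to a random offset common
  to all candidates.  Above: the selected \<open>h \<omega>\<close> beats \<open>l0\<close> on the criterion, hence up to
  \<open>2 * Z \<omega>\<close> on the ideal loss, and passing between the ideal and the true loss costs \<open>V \<omega>\<close>
  twice.  Below: a random selection cannot be compared with \<open>l0\<close> through \<open>best\<close>, which concerns
  fixed candidates, but \<open>best\<close> bounds the ideal loss of every candidate from below, and this
  bound may then be evaluated at \<open>h \<omega>\<close>.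
\<close>
lemma (in prob_space) selection_risk_gap:
  fixes loss crit :: "'l \<Rightarrow> 'a \<Rightarrow> real" and ideal :: "'l \<Rightarrow> real"
  assumes V: "integrable M V" and Z: "integrable M Z"
    and lm: "\<And>l. l \<in> \<Lambda> \<Longrightarrow> loss l \<in> borel_measurable M"
    and hm: "(\<lambda>\<omega>. loss (h \<omega>) \<omega>) \<in> borel_measurable M"
    and nonneg: "\<And>l \<omega>. 0 \<le> loss l \<omega>"
    and loss: "\<And>l \<omega>. l \<in> \<Lambda> \<Longrightarrow> \<bar>loss l \<omega> - ideal l\<bar> \<le> V \<omega>"
    and crit: "\<And>l \<omega>. l \<in> \<Lambda> \<Longrightarrow> \<bar>crit l \<omega> - offset \<omega> - ideal l\<bar> \<le> Z \<omega>"
    and h: "\<And>\<omega>. \<omega> \<in> space M \<Longrightarrow> h \<omega> \<in> \<Lambda>"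
    and l0: "l0 \<in> \<Lambda>"
    and hmin: "\<And>\<omega>. \<omega> \<in> space M \<Longrightarrow> crit (h \<omega>) \<omega> \<le> crit l0 \<omega>"
    and best: "\<And>l. l \<in> \<Lambda> \<Longrightarrow> (\<integral>\<omega>. loss l0 \<omega> \<partial>M) \<le> (\<integral>\<omega>. loss l \<omega> \<partial>M)"
  shows "\<bar>(\<integral>\<omega>. loss (h \<omega>) \<omega> \<partial>M) - (\<integral>\<omega>. loss l0 \<omega> \<partial>M)\<bar> \<le> 2 * ((\<integral>\<omega>. V \<omega> \<partial>M) + (\<integral>\<omega>. Z \<omega> \<partial>M))"
proof -
  have int: "integrable M (loss l)" if "l \<in> \<Lambda>" for l
  proof (rule Bochner_Integration.integrable_bound[of M "\<lambda>\<omega>. ideal l + V \<omega>"])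
    have "norm (loss l \<omega>) \<le> norm (ideal l + V \<omega>)" for \<omega> using loss[OF that, of \<omega>] nonneg[of l \<omega>] by simp
    then show "AE \<omega> in M. norm (loss l \<omega>) \<le> norm (ideal l + V \<omega>)" by simp
  qed (use V lm that in auto)
  have upper: "loss (h \<omega>) \<omega> \<le> loss l0 \<omega> + 2 * (V \<omega> + Z \<omega>)" if "\<omega> \<in> space M" for \<omega>
  proof -
    have "loss (h \<omega>) \<omega> \<le> ideal (h \<omega>) + V \<omega>" using loss[OF h[OF that], of \<omega>] by linarith
    moreover have "ideal (h \<omega>) \<le> crit (h \<omega>) \<omega> - offset \<omega> + Z \<omega>" using crit[OF h[OF that], of \<omega>] by linarith
    moreover have "crit l0 \<omega> - offset \<omega> \<le> ideal l0 + Z \<omega>" using crit[OF l0, of \<omega>] by linarith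
    moreover have "ideal l0 \<le> loss l0 \<omega> + V \<omega>" using loss[OF l0, of \<omega>] by linarith
    ultimately show ?thesis using hmin[OF that] unfolding distrib_left by linarith
  qed
  have inth: "integrable M (\<lambda>\<omega>. loss (h \<omega>) \<omega>)"
  proof (rule Bochner_Integration.integrable_bound[of M "\<lambda>\<omega>. loss l0 \<omega> + 2 * (V \<omega> + Z \<omega>)"])
    have "norm (loss (h \<omega>) \<omega>) \<le> norm (loss l0 \<omega> + 2 * (V \<omega> + Z \<omega>))" if "\<omega> \<in> space M" for \<omega>
      using upper[OF that] nonneg[of "h \<omega>" \<omega>] by simp
    then show "AE \<omega> in M. norm (loss (h \<omega>) \<omega>) \<le> norm (loss l0 \<omega> + 2 * (V \<omega> + Z \<omega>))" by (rule AE_I2)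
  qed (use V Z int[OF l0] hm in auto)
  have "(\<integral>\<omega>. loss (h \<omega>) \<omega> \<partial>M) \<le> (\<integral>\<omega>. loss l0 \<omega> + 2 * (V \<omega> + Z \<omega>) \<partial>M)"
    using inth int[OF l0] V Z upper by (intro integral_mono) auto
  then have 1: "(\<integral>\<omega>. loss (h \<omega>) \<omega> \<partial>M) \<le> (\<integral>\<omega>. loss l0 \<omega> \<partial>M) + 2 * ((\<integral>\<omega>. V \<omega> \<partial>M) + (\<integral>\<omega>. Z \<omega> \<partial>M))"
    using int[OF l0] V Z by simp
  have low: "(\<integral>\<omega>. loss l0 \<omega> \<partial>M) - (\<integral>\<omega>. V \<omega> \<partial>M) \<le> ideal l" if l: "l \<in> \<Lambda>" for l
  proof -
    have "loss l \<omega> \<le> ideal l + V \<omega>" for \<omega> using loss[OF l, of \<omega>] by linarith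
    then have "(\<integral>\<omega>. loss l \<omega> \<partial>M) \<le> (\<integral>\<omega>. ideal l + V \<omega> \<partial>M)"
      using int[OF l] V by (intro integral_mono) auto
    then show ?thesis using best[OF l] V by (simp add: prob_space)
  qed
  have "(\<integral>\<omega>. (\<integral>\<omega>'. loss l0 \<omega>' \<partial>M) - (\<integral>\<omega>'. V \<omega>' \<partial>M) - V \<omega> \<partial>M) \<le> (\<integral>\<omega>. loss (h \<omega>) \<omega> \<partial>M)"
  proof (rule integral_mono)
    fix \<omega> assume "\<omega> \<in> space M"
    from low[OF h[OF this]] loss[OF h[OF this], of \<omega>]
    show "(\<integral>\<omega>'. loss l0 \<omega>' \<partial>M) - (\<integral>\<omega>'. V \<omega>' \<partial>M) - V \<omega> \<le> loss (h \<omega>) \<omega>" by linarith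
  qed (use V inth in auto)
  then have 2: "(\<integral>\<omega>. loss l0 \<omega> \<partial>M) - 2 * (\<integral>\<omega>. V \<omega> \<partial>M) \<le> (\<integral>\<omega>. loss (h \<omega>) \<omega> \<partial>M)"
    using V by (simp add: prob_space)
  have "Z \<omega> \<ge> 0" for \<omega> using crit[OF l0, of \<omega>] by linarith
  then have "0 \<le> (\<integral>\<omega>. Z \<omega> \<partial>M)" by simp
  then show ?thesis using 1 2 unfolding distrib_left by linarith
qed

lemma pred_risk_random_eq_expected_gram_form:
  "pred_risk_random M W X \<theta> \<sigma> n L
    = (\<integral>\<omega>. gram_form {..<n} X (lasso {..<n} X (\<lambda>i. X i \<bullet> \<theta> + \<sigma> * W i \<omega>) (L \<omega>) - \<theta>) \<partial>M) + \<sigma>\<^sup>2"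
  by (simp add: pred_risk_random_def gram_form_def response_def[abs_def])

theorem theorem2p1:
  fixes M :: "'a measure"
    and W :: "nat \<Rightarrow> 'a \<Rightarrow> real"
    and P :: "nat \<Rightarrow> real measure"
    and X :: "nat \<Rightarrow> real^'p"
    and \<theta> :: "real^'p"
    and C :: "real^'p^'p"
    and \<sigma> c_min C_X C_\<theta> \<tau> :: real
    and \<Lambda> :: "real set"
    and lam_hat :: "nat \<Rightarrow> 'a \<Rightarrow> real"
    and lam :: "nat \<Rightarrow> real"
  assumes sigma_pos: "\<sigma> > 0"
    and full_rank: "\<forall>\<^sub>F n in sequentially. full_column_rank X n"
    and A: "(\<lambda>n. sample_gram X n) \<longlonglongrightarrow> C"
           "pos_def_matrix C" "smallest_eigenvalue C c_min" "c_min > 0"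
    and B: "\<forall>i. norm (X i) \<le> C_X"
    and C_bound: "l1_norm \<theta> \<le> C_\<theta>"
    and prob: "prob_space M"
    and D: "prob_space.indep_vars M (\<lambda>_. borel) W UNIV"
           "\<forall>i. distr M borel (W i) = P i"
           "\<forall>i. subgaussian_mgf \<tau> (P i)"
    and Lambda: "compact \<Lambda>" "\<Lambda> \<subseteq> {0..}"
    and cv: "\<forall>\<^sub>F n in sequentially. cv_parameter M W X \<theta> \<sigma> \<Lambda> n (lam_hat n)"
    and best: "\<forall>\<^sub>F n in sequentially. risk_minimizer M W X \<theta> \<sigma> n (lam n) \<and> lam n \<in> \<Lambda>"
  shows "(\<lambda>n. pred_risk_random M W X \<theta> \<sigma> n (lam_hat n) - pred_risk M W X \<theta> \<sigma> n (lam n))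
           \<longlonglongrightarrow> 0"
proof -
  have bX: "norm (X i) \<le> C_X" for i using B by blast
  have meas: "W i \<in> borel_measurable M" for i using D(1) by (auto simp: prob_space.indep_vars_def[OF prob])
  have sg: "subgaussian_mgf \<tau> (distr M borel (W i))" for i using D by simp
  note moments = prob_space.subgaussian_moments[OF prob meas sg]
  define env where "env n \<omega> = noise_envelope X (\<lambda>i. \<sigma> * W i \<omega>) n" for n \<omega>
  define Q where "Q = 1 + \<sigma>\<^sup>2 * (4 * exp (\<tau>\<^sup>2 / 2)) * C_X\<^sup>2 + \<sigma>\<^sup>2 * (4 * exp (\<tau>\<^sup>2 / 2))"
  have env_int: "integrable M (env n)" and env_le: "(\<integral>\<omega>. env n \<omega> \<partial>M) \<le> Q / sqrt n"
    if "n \<ge> 1" for n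
    unfolding env_def Q_def
    using prob_space.expected_noise_envelope[where X = X and \<sigma> = \<sigma>, OF prob D(1) moments(2,1,3,4) bX that] by blast+
  have env_lim: "(\<lambda>n. \<integral>\<omega>. env n \<omega> \<partial>M) \<longlonglongrightarrow> 0"
  proof (rule tendsto_sandwich[where f = "\<lambda>_. 0" and h = "\<lambda>n. Q / sqrt (real n)"])
    show "(\<lambda>n. Q / sqrt (real n)) \<longlonglongrightarrow> 0"
      by (intro tendsto_divide_0[OF tendsto_const] filterlim_at_top_imp_at_infinity
          filterlim_compose[OF sqrt_at_top filterlim_real_sequentially])
    show "\<forall>\<^sub>F n in sequentially. (\<integral>\<omega>. env n \<omega> \<partial>M) \<le> Q / sqrt (real n)"
      using eventually_ge_at_top[of 1] by eventually_elim (rule env_le)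
    have "0 \<le> env n \<omega>" for n \<omega>
      by (auto simp: env_def noise_envelope_def intro!: add_nonneg_nonneg divide_nonneg_nonneg sum_nonneg)
    then show "\<forall>\<^sub>F n in sequentially. 0 \<le> (\<integral>\<omega>. env n \<omega> \<partial>M)" by simp
  qed simp
  obtain c where c: "c > 0" and co: "\<forall>\<^sub>F n in sequentially. (\<forall>v. c * (norm v)\<^sup>2 \<le> gram_form {..<n} X v) \<and>
       (\<forall>i<n. \<forall>v. c * (norm v)\<^sup>2 \<le> gram_form ({..<n} - {i}) X v)"
    using eventually_gram_form_coercive[OF A(1,2) bX] by blast
  obtain b where b: "\<And>l. l \<in> \<Lambda> \<Longrightarrow> l \<le> b"
    using compact_imp_bounded[OF Lambda(1)] bounded_imp_bdd_above unfolding bdd_above_def by blast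
  have L0: "0 \<le> l" if "l \<in> \<Lambda>" for l using that Lambda(2) by auto
  define K where "K = real CARD('p) * b / c"
  define \<kappa>1 where "\<kappa>1 = C_X\<^sup>2 / c\<^sup>2 + 2 * C_X\<^sup>2 * K / c"
  define \<kappa>2 where "\<kappa>2 = 2 * C_X + 2 * C_X^3 * K\<^sup>2
    + (C_X + C_X\<^sup>2) / c\<^sup>2 * (8 + 64 * C_X^4 * K\<^sup>2 + 16 * C_X\<^sup>2) + 2 * K"
  have gap: "\<forall>\<^sub>F n in sequentially.
      norm (pred_risk_random M W X \<theta> \<sigma> n (lam_hat n) - pred_risk M W X \<theta> \<sigma> n (lam n))
        \<le> 2 * ((\<kappa>1 + \<kappa>2) * (\<integral>\<omega>. env n \<omega> \<partial>M))"
    using co cv best eventually_ge_at_top[of 2]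
  proof eventually_elim
    case (elim n)
    have n: "n \<ge> 2" by fact
    have full: "\<And>v. c * (norm v)\<^sup>2 \<le> gram_form {..<n} X v"
      and loo: "\<And>i v. i < n \<Longrightarrow> c * (norm v)\<^sup>2 \<le> gram_form ({..<n} - {i}) X v" using elim by auto
    let ?y = "\<lambda>\<omega> i. X i \<bullet> \<theta> + \<sigma> * W i \<omega>"
    define loss where "loss l \<omega> = gram_form {..<n} X (lasso {..<n} X (?y \<omega>) l - \<theta>)" for l \<omega>
    define ideal where "ideal l = gram_form {..<n} X (lasso {..<n} X (\<lambda>i. X i \<bullet> \<theta>) l - \<theta>)" for l
    have hm: "lam_hat n \<in> borel_measurable M" and hL: "\<And>\<omega>. \<omega> \<in> space M \<Longrightarrow> lam_hat n \<omega> \<in> \<Lambda>"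
      and hmin: "\<And>\<omega> l. \<omega> \<in> space M \<Longrightarrow> l \<in> \<Lambda> \<Longrightarrow> loocv_risk X (?y \<omega>) n (lam_hat n \<omega>) \<le> loocv_risk X (?y \<omega>) n l"
      using elim(2) unfolding cv_parameter_def is_arg_min_def response_def[abs_def] by (auto simp: not_less)
    have lossm: "(\<lambda>\<omega>. loss (L \<omega>) \<omega>) \<in> borel_measurable M"
      if "L \<in> borel_measurable M" "\<And>\<omega>. \<omega> \<in> space M \<Longrightarrow> 0 \<le> L \<omega>" for L
    proof -
      have [measurable]: "(\<lambda>\<omega>. lasso {..<n} X (?y \<omega>) (L \<omega>)) \<in> borel_measurable M"
        by (rule borel_measurable_lasso[OF c full _ that]) (use meas in auto)
      show ?thesis unfolding loss_def gram_form_def by measurable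
    qed
    have risk: "pred_risk M W X \<theta> \<sigma> n l = (\<integral>\<omega>. loss l \<omega> \<partial>M) + \<sigma>\<^sup>2" for l
      by (simp add: pred_risk_def pred_risk_random_eq_expected_gram_form loss_def)
    have "\<bar>(\<integral>\<omega>. loss (lam_hat n \<omega>) \<omega> \<partial>M) - (\<integral>\<omega>. loss (lam n) \<omega> \<partial>M)\<bar>
        \<le> 2 * ((\<integral>\<omega>. \<kappa>1 * env n \<omega> \<partial>M) + (\<integral>\<omega>. \<kappa>2 * env n \<omega> \<partial>M))"
    proof (rule prob_space.selection_risk_gap[OF prob, where \<Lambda> = \<Lambda> and ideal = ideal and crit = "\<lambda>l \<omega>. loocv_risk X (?y \<omega>) n l"
          and offset = "\<lambda>\<omega>. (\<Sum>i<n. (\<sigma> * W i \<omega>)\<^sup>2) / real n"])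
      show "integrable M (\<lambda>\<omega>. \<kappa>1 * env n \<omega>)" "integrable M (\<lambda>\<omega>. \<kappa>2 * env n \<omega>)"
        using n by (auto intro!: integrable_mult_right env_int)
      show "loss l \<in> borel_measurable M" if "l \<in> \<Lambda>" for l
        using lossm[of "\<lambda>_. l"] L0[OF that] by simp
      show "(\<lambda>\<omega>. loss (lam_hat n \<omega>) \<omega>) \<in> borel_measurable M"
        by (rule lossm[OF hm L0[OF hL]])
      show "0 \<le> loss l \<omega>" for l \<omega> by (simp add: loss_def gram_form_def sum_nonneg)
      show "\<bar>loss l \<omega> - ideal l\<bar> \<le> \<kappa>1 * env n \<omega>" if "l \<in> \<Lambda>" for l \<omega>
        unfolding loss_def ideal_def env_def \<kappa>1_def K_def
        using n by (intro full_sample_approximation[OF _ c full bX L0[OF that] b[OF that]]) auto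
      show "\<bar>loocv_risk X (?y \<omega>) n l - (\<Sum>i<n. (\<sigma> * W i \<omega>)\<^sup>2) / real n - ideal l\<bar> \<le> \<kappa>2 * env n \<omega>"
        if "l \<in> \<Lambda>" for l \<omega>
        unfolding ideal_def env_def \<kappa>2_def K_def
        by (rule cross_validation_approximation[OF n c full loo bX L0[OF that] b[OF that]])
      show "lam_hat n \<omega> \<in> \<Lambda>" if "\<omega> \<in> space M" for \<omega> by (rule hL[OF that])
      show "lam n \<in> \<Lambda>" using elim by blast
      then show "loocv_risk X (?y \<omega>) n (lam_hat n \<omega>) \<le> loocv_risk X (?y \<omega>) n (lam n)" if "\<omega> \<in> space M" for \<omega>
        by (rule hmin[OF that])
      show "(\<integral>\<omega>. loss (lam n) \<omega> \<partial>M) \<le> (\<integral>\<omega>. loss l \<omega> \<partial>M)" if "l \<in> \<Lambda>" for l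
        using elim(3) L0[OF that] unfolding risk_minimizer_def is_arg_min_def risk
        by (auto simp: not_less)
    qed
    then show ?case
      by (simp add: risk pred_risk_random_eq_expected_gram_form loss_def[symmetric] distrib_right)
  qed
  have "(\<lambda>n. 2 * ((\<kappa>1 + \<kappa>2) * (\<integral>\<omega>. env n \<omega> \<partial>M))) \<longlonglongrightarrow> 2 * ((\<kappa>1 + \<kappa>2) * 0)"
    by (intro tendsto_mult_left env_lim)
  then have "(\<lambda>n. 2 * ((\<kappa>1 + \<kappa>2) * (\<integral>\<omega>. env n \<omega> \<partial>M))) \<longlonglongrightarrow> 0" by simp
  with gap show ?thesis by (rule Lim_null_comparison)
qed

end
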